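(* Let $G=(V(G),E(G))$ be a finite simple connected graph with vertex set $V(G)=\{x_1,\ldots,x_n\}$, let $K$ be a field, $R=K[x_1,\ldots,x_n]$, and let $J(G)=\bigcap_{\{x_i,x_j\}\in E(G)}(x_i,x_j)\subset R$ be the cover ideal of $G$. Then $J(G)$ has the nearly copersistence property if and only if $G$ is either a bipartite graph or an almost bipartite graph.
   Context: A monomial ideal $I$ in a polynomial ring $R=K[x_1,\ldots,x_n]$ over a field $K$ has the nearly copersistence property if there exist a positive integer $s$ and a monomial prime ideal $\mathfrak{p}$ of $R$ such that $\mathrm{Ass}_R(R/I^m)\cup\{\mathfrak{p}\}\supseteq \mathrm{Ass}_R(R/I^{m+1})$ for all $1\le m\le s$, and $\mathrm{Ass}_R(R/I^m)\supseteq\mathrm{Ass}_R(R/I^{m+1})$ for all $m\ge s+1$. A finite simple connected graph is called almost bipartite if it has exactly one induced subgraph that is an odd cycle. *)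

theory Defs
  imports Main "HOL-Library.Poly_Mapping"
begin

type_synonym ('v, 'k) mpoly = "('v \<Rightarrow>\<^sub>0 nat) \<Rightarrow>\<^sub>0 'k"

definition var :: "'v \<Rightarrow> ('v, 'k::comm_ring_1) mpoly" where
  "var v = Poly_Mapping.single (Poly_Mapping.single v 1) 1"

definition is_ideal :: "'a::comm_ring_1 set \<Rightarrow> bool" where
  "is_ideal I \<longleftrightarrow> 0 \<in> I \<and> (\<forall>a\<in>I. \<forall>b\<in>I. a + b \<in> I) \<and> (\<forall>r. \<forall>a\<in>I. r * a \<in> I)"

definition ideal_gen :: "'a::comm_ring_1 set \<Rightarrow> 'a set" where
  "ideal_gen S = \<Inter>{I. is_ideal I \<and> S \<subseteq> I}"

definition ideal_prod :: "'a::comm_ring_1 set \<Rightarrow> 'a set \<Rightarrow> 'a set" where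
  "ideal_prod I J = ideal_gen {a * b | a b. a \<in> I \<and> b \<in> J}"

fun ideal_pow :: "'a::comm_ring_1 set \<Rightarrow> nat \<Rightarrow> 'a set" where
  "ideal_pow I 0 = UNIV"
| "ideal_pow I (Suc m) = ideal_prod (ideal_pow I m) I"

definition prime_ideal :: "'a::comm_ring_1 set \<Rightarrow> bool" where
  "prime_ideal P \<longleftrightarrow> is_ideal P \<and> P \<noteq> UNIV \<and> (\<forall>a b. a * b \<in> P \<longrightarrow> a \<in> P \<or> b \<in> P)"

text \<open>Colon ideal I : f, i.e. the annihilator of the class of f in R/I.\<close>
definition colon :: "'a::comm_ring_1 set \<Rightarrow> 'a \<Rightarrow> 'a set" where
  "colon I f = {g. g * f \<in> I}"

text \<open>Ass_R(R/I): prime ideals that are annihilators of elements of R/I.\<close>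
definition Ass :: "'a::comm_ring_1 set \<Rightarrow> 'a set set" where
  "Ass I = {P. prime_ideal P \<and> (\<exists>f. P = colon I f)}"

definition monomial_prime :: "('v, 'k::field) mpoly set \<Rightarrow> bool" where
  "monomial_prime P \<longleftrightarrow> (\<exists>A. P = ideal_gen (var ` A))"

definition nearly_copersistent :: "('v, 'k::field) mpoly set \<Rightarrow> bool" where
  "nearly_copersistent I \<longleftrightarrow>
     (\<exists>s::nat. \<exists>p. s \<ge> 1 \<and> monomial_prime p \<and>
        (\<forall>m. 1 \<le> m \<and> m \<le> s \<longrightarrow> Ass (ideal_pow I (m+1)) \<subseteq> Ass (ideal_pow I m) \<union> {p}) \<and>
        (\<forall>m. m \<ge> s + 1 \<longrightarrow> Ass (ideal_pow I (m+1)) \<subseteq> Ass (ideal_pow I m)))"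

definition simple_graph :: "('v \<Rightarrow> 'v \<Rightarrow> bool) \<Rightarrow> bool" where
  "simple_graph E \<longleftrightarrow> (\<forall>u v. E u v \<longrightarrow> E v u) \<and> (\<forall>v. \<not> E v v)"

definition connected_graph :: "('v \<Rightarrow> 'v \<Rightarrow> bool) \<Rightarrow> bool" where
  "connected_graph E \<longleftrightarrow> (\<forall>u v. E\<^sup>*\<^sup>* u v)"

definition bipartite :: "('v \<Rightarrow> 'v \<Rightarrow> bool) \<Rightarrow> bool" where
  "bipartite E \<longleftrightarrow> (\<exists>c :: 'v \<Rightarrow> bool. \<forall>u v. E u v \<longrightarrow> c u \<noteq> c v)"

definition induced_odd_cycle :: "('v \<Rightarrow> 'v \<Rightarrow> bool) \<Rightarrow> 'v set \<Rightarrow> bool" where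
  "induced_odd_cycle E S \<longleftrightarrow>
     (\<exists>k f. odd k \<and> k \<ge> 3 \<and> bij_betw f {..<k} S \<and>
        (\<forall>i<k. \<forall>j<k. E (f i) (f j) \<longleftrightarrow> (j = Suc i mod k \<or> i = Suc j mod k)))"

definition almost_bipartite :: "('v \<Rightarrow> 'v \<Rightarrow> bool) \<Rightarrow> bool" where
  "almost_bipartite E \<longleftrightarrow> (\<exists>!S. induced_odd_cycle E S)"

definition cover_ideal :: "('v \<Rightarrow> 'v \<Rightarrow> bool) \<Rightarrow> ('v, 'k::field) mpoly set" where
  "cover_ideal E = \<Inter>{ideal_gen {var u, var v} | u v. E u v}"

end

theory Submission
  imports Defs "HOL-Library.Set_Algebras" "HOL-Library.Countable" "HOL-Number_Theory.Cong"
begin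

text \<open>
  For a set \<open>A\<close> of variables, the monomials of degree at least \<open>t\<close> in \<open>A\<close> span an ideal that is primary
  to the prime \<open>p A\<close> generated by \<open>A\<close>. If \<open>J\<^sup>m\<close> is cut out by finitely many such degree conditions, its
  associated primes are therefore among the corresponding \<open>p A\<close>.

  Call a weight on the vertices a cover of order \<open>m\<close> if it adds up to at least \<open>m\<close> on every edge. A monomial
  lies in \<open>J\<^sup>m\<close> iff its exponent dominates a sum of \<open>m\<close> vertex covers; such an exponent is a cover of order
  \<open>m\<close> with total weight at least \<open>m * (l + 1)\<close> on every induced cycle of length \<open>2 * l + 1\<close>. If \<open>G\<close> is
  bipartite, or if it has exactly one induced odd cycle \<open>S\<close>, these conditions are also sufficient. In the
  second case fix \<open>v \<in> S\<close>; then \<open>G - v\<close> is bipartite, and one splits the cover \<open>b\<close> into covers of orders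
  \<open>m - b v\<close> and \<open>b v\<close>, the first one vanishing at \<open>v\<close>, to each of which the bipartite argument applies.
  The split is a system of difference constraints, whose only possible obstruction is an odd closed walk
  through \<open>v\<close> of too small weight; chords reduce odd closed walks to \<open>S\<close>.

  Conversely, every induced odd cycle \<open>S\<close> makes \<open>p S\<close> an associated prime of \<open>J\<^sup>m\<close> for every \<open>m \<ge> 2\<close>, but
  not of \<open>J\<close>, so two such cycles contradict near copersistence already at \<open>m = 1\<close>.
\<close>

abbreviation lookup :: "('a \<Rightarrow>\<^sub>0 'b::zero) \<Rightarrow> 'a \<Rightarrow> 'b" where
  "lookup \<equiv> Poly_Mapping.lookup"

abbreviation keys :: "('a \<Rightarrow>\<^sub>0 'b::zero) \<Rightarrow> 'a set" where
  "keys \<equiv> Poly_Mapping.keys"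

abbreviation single :: "'a \<Rightarrow> 'b::zero \<Rightarrow> 'a \<Rightarrow>\<^sub>0 'b" where
  "single \<equiv> Poly_Mapping.single"

section \<open>Ideals and associated primes\<close>

lemma is_ideal_mult: "is_ideal I \<Longrightarrow> a \<in> I \<Longrightarrow> r * a \<in> I"
  by (simp add: is_ideal_def)

lemma is_ideal_sum:
  assumes "is_ideal I" "\<And>x. x \<in> X \<Longrightarrow> f x \<in> I"
  shows "sum f X \<in> I"
  using assms(2) by (induction X rule: infinite_finite_induct)
    (use assms(1) in \<open>auto simp: is_ideal_def\<close>)

lemma is_ideal_Inter: "(\<And>I. I \<in> \<I> \<Longrightarrow> is_ideal I) \<Longrightarrow> is_ideal (\<Inter>\<I>)"
  unfolding is_ideal_def by blast

lemma is_ideal_ideal_gen: "is_ideal (ideal_gen S)"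
  unfolding ideal_gen_def by (rule is_ideal_Inter) blast

lemma subset_ideal_gen: "S \<subseteq> ideal_gen S"
  unfolding ideal_gen_def by blast

lemma ideal_gen_minimal: "is_ideal I \<Longrightarrow> S \<subseteq> I \<Longrightarrow> ideal_gen S \<subseteq> I"
  unfolding ideal_gen_def by blast

lemma is_ideal_colon:
  assumes "is_ideal I"
  shows "is_ideal (colon I f)"
  using assms unfolding is_ideal_def colon_def by (simp add: distrib_right mult.assoc)

lemma ideal_pow_1:
  assumes "is_ideal I"
  shows "ideal_pow I 1 = I"
proof -
  have "ideal_gen {a * b |a b. a \<in> UNIV \<and> b \<in> I} = I"
  proof
    show "ideal_gen {a * b |a b. a \<in> UNIV \<and> b \<in> I} \<subseteq> I"
      using assms by (intro ideal_gen_minimal) (auto simp: is_ideal_mult)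
    have "I \<subseteq> {a * b |a b. a \<in> UNIV \<and> b \<in> I}"
      by (force intro: exI[of _ 1])
    then show "I \<subseteq> ideal_gen {a * b |a b. a \<in> UNIV \<and> b \<in> I}"
      using subset_ideal_gen by blast
  qed
  then show ?thesis
    by (simp add: ideal_prod_def)
qed

lemma prime_ideal_prodD:
  assumes prime: "prime_ideal P" and "finite X" "(\<Prod>x\<in>X. f x) \<in> P"
  shows "\<exists>x\<in>X. f x \<in> P"
  using assms(2,3)
proof (induction X rule: finite_induct)
  case empty
  then have "r * 1 \<in> P" for r
    using prime is_ideal_mult unfolding prime_ideal_def prod.empty by blast
  then show ?case
    using prime by (auto simp: prime_ideal_def)
next
  case (insert x X)
  then show ?case
    using prime by (auto simp: prime_ideal_def)
qed

lemma prime_ideal_powerD: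
  assumes "prime_ideal P" "x ^ n \<in> P"
  shows "x \<in> P"
  using prime_ideal_prodD[OF assms(1), of "{..<n}" "\<lambda>_. x"] assms(2) by auto

lemma prime_ideal_INT_subsetD:
  assumes prime: "prime_ideal P" and "finite X" and ideal: "\<And>x. x \<in> X \<Longrightarrow> is_ideal (I x)"
    and subset: "(\<Inter>x\<in>X. I x) \<subseteq> P"
  shows "\<exists>x\<in>X. I x \<subseteq> P"
proof (rule ccontr)
  assume "\<not> ?thesis"
  then have "\<forall>x\<in>X. \<exists>g. g \<in> I x \<and> g \<notin> P"
    by blast
  then obtain g where in_I: "\<And>x. x \<in> X \<Longrightarrow> g x \<in> I x" and not_in_P: "\<And>x. x \<in> X \<Longrightarrow> g x \<notin> P"
    by metis
  have "prod g X \<in> I x" if "x \<in> X" for x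
  proof -
    have "prod g X = prod g (X - {x}) * g x"
      using \<open>finite X\<close> that by (simp add: prod.remove mult.commute)
    then show ?thesis
      using is_ideal_mult[OF ideal[OF that] in_I[OF that]] by simp
  qed
  then show False
    using subset prime_ideal_prodD[OF prime \<open>finite X\<close>, of g] not_in_P by blast
qed

lemma Ass_INT_subset:
  assumes "finite X" "\<And>x. x \<in> X \<Longrightarrow> is_ideal (I x)"
  shows "Ass (\<Inter>x\<in>X. I x) \<subseteq> (\<Union>x\<in>X. Ass (I x))"
proof
  fix P assume "P \<in> Ass (\<Inter>x\<in>X. I x)"
  then obtain f where "prime_ideal P" "P = colon (\<Inter>x\<in>X. I x) f"
    by (auto simp: Ass_def)
  then have P_eq: "P = (\<Inter>x\<in>X. colon (I x) f)"
    by (auto simp: colon_def)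
  have "\<exists>x\<in>X. colon (I x) f \<subseteq> P"
    using P_eq by (intro prime_ideal_INT_subsetD[OF \<open>prime_ideal P\<close> assms(1)] is_ideal_colon assms(2)) auto
  then obtain x where "x \<in> X" "P = colon (I x) f"
    using P_eq by blast
  then show "P \<in> (\<Union>x\<in>X. Ass (I x))"
    using \<open>prime_ideal P\<close> by (auto simp: Ass_def)
qed

lemma Ass_primary_subset:
  assumes ideal: "is_ideal Q" and primary: "\<And>f g. g * f \<in> Q \<Longrightarrow> f \<notin> Q \<Longrightarrow> g \<in> ideal_gen S"
    and radical: "\<And>x. x \<in> S \<Longrightarrow> \<exists>n. x ^ n \<in> Q"
  shows "Ass Q \<subseteq> {ideal_gen S}"
proof
  fix P assume "P \<in> Ass Q"
  then obtain f where prime: "prime_ideal P" and P_eq: "P = colon Q f"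
    by (auto simp: Ass_def)
  have "f \<notin> Q"
    using prime P_eq is_ideal_mult[OF ideal] by (auto simp: prime_ideal_def colon_def)
  then have "P \<subseteq> ideal_gen S"
    using primary by (auto simp: P_eq colon_def)
  moreover have "x \<in> P" if "x \<in> S" for x
  proof -
    obtain n where "x ^ n \<in> Q"
      using radical[OF \<open>x \<in> S\<close>] ..
    then have "x ^ n \<in> P"
      using is_ideal_mult[OF ideal, of "x ^ n" f] by (simp add: P_eq colon_def mult.commute)
    then show ?thesis
      by (rule prime_ideal_powerD[OF prime])
  qed
  then have "ideal_gen S \<subseteq> P"
    using prime by (intro ideal_gen_minimal) (auto simp: prime_ideal_def)
  ultimately show "P \<in> {ideal_gen S}"
    by blast
qed

section \<open>Monomial ideals\<close>

definition upclosed :: "('v \<Rightarrow>\<^sub>0 nat) set \<Rightarrow> bool" where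
  "upclosed U \<longleftrightarrow> (\<forall>a\<in>U. \<forall>b. b + a \<in> U)"

definition mon_ideal :: "('v \<Rightarrow>\<^sub>0 nat) set \<Rightarrow> ('v, 'k::comm_ring_1) mpoly set" where
  "mon_ideal U = {f. keys f \<subseteq> U}"

lemma single_in_mon_ideal [simp]:
  "(single a 1 :: ('v, 'k::comm_ring_1) mpoly) \<in> mon_ideal U \<longleftrightarrow> a \<in> U"
  by (simp add: mon_ideal_def)

lemma is_ideal_mon_ideal:
  assumes "upclosed U"
  shows "is_ideal (mon_ideal U :: ('v, 'k::comm_ring_1) mpoly set)"
  unfolding is_ideal_def mon_ideal_def
proof (intro conjI ballI allI)
  fix r f :: "('v, 'k) mpoly" assume "f \<in> {f. keys f \<subseteq> U}"
  then show "r * f \<in> {f. keys f \<subseteq> U}"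
    using assms keys_mult[of r f] unfolding upclosed_def by blast
next
  fix f g :: "('v, 'k) mpoly" assume "f \<in> {f. keys f \<subseteq> U}" "g \<in> {f. keys f \<subseteq> U}"
  then show "f + g \<in> {f. keys f \<subseteq> U}"
    using keys_add[of f g] by blast
qed auto

lemma sum_monomials: "f = (\<Sum>a\<in>keys f. single a (lookup f a))"
  by (rule poly_mapping_eqI)
    (auto simp: lookup_sum lookup_single when_def not_in_keys_iff_lookup_eq_zero)

lemma mon_ideal_subset_ideal:
  assumes ideal: "is_ideal I" and monomials: "\<And>a. a \<in> U \<Longrightarrow> single a 1 \<in> I"
  shows "(mon_ideal U :: ('v, 'k::comm_ring_1) mpoly set) \<subseteq> I"
proof
  fix f :: "('v, 'k) mpoly" assume "f \<in> mon_ideal U"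
  have "single a (lookup f a) \<in> I" if "a \<in> keys f" for a
  proof -
    have "single 0 (lookup f a) * single a 1 \<in> I"
      using \<open>f \<in> mon_ideal U\<close> that
      by (intro is_ideal_mult[OF ideal] monomials) (auto simp: mon_ideal_def)
    then show ?thesis
      by (simp add: mult_single)
  qed
  then show "f \<in> I"
    using is_ideal_sum[OF ideal] sum_monomials[of f] by metis
qed

lemma upclosed_plus:
  assumes "upclosed U"
  shows "upclosed (U + V)"
  unfolding upclosed_def
proof (intro ballI allI)
  fix a b assume "a \<in> U + V"
  then obtain u v where "a = u + v" "u \<in> U" "v \<in> V"
    by (rule set_plus_elim)
  then show "b + a \<in> U + V"
    using assms set_plus_intro[of "b + u" U v V] by (simp add: upclosed_def add.assoc)
qed

lemma ideal_prod_mon_ideal: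
  assumes "upclosed U"
  shows "ideal_prod (mon_ideal U) (mon_ideal V)
    = (mon_ideal (U + V) :: ('v, 'k::comm_ring_1) mpoly set)"
proof
  have "f * g \<in> mon_ideal (U + V)" if "f \<in> mon_ideal U" "g \<in> mon_ideal V" for f g :: "('v, 'k) mpoly"
    using that keys_mult[of f g] unfolding mon_ideal_def by (blast intro: set_plus_intro)
  then show "ideal_prod (mon_ideal U) (mon_ideal V) \<subseteq> (mon_ideal (U + V) :: ('v, 'k) mpoly set)"
    unfolding ideal_prod_def
    by (intro ideal_gen_minimal is_ideal_mon_ideal upclosed_plus assms) blast
  show "(mon_ideal (U + V) :: ('v, 'k) mpoly set) \<subseteq> ideal_prod (mon_ideal U) (mon_ideal V)"
    unfolding ideal_prod_def
  proof (rule mon_ideal_subset_ideal[OF is_ideal_ideal_gen])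
    fix c assume "c \<in> U + V"
    then obtain a b where "c = a + b" "a \<in> U" "b \<in> V"
      by (rule set_plus_elim)
    then have "single c 1 = single a (1::'k) * single b 1"
        "single a (1::'k) \<in> mon_ideal U" "single b (1::'k) \<in> mon_ideal V"
      by (simp_all add: mult_single)
    then show "single c (1::'k) \<in> ideal_gen {f * g |f g. f \<in> mon_ideal U \<and> g \<in> mon_ideal V}"
      by (intro subsetD[OF subset_ideal_gen]) blast
  qed
qed

fun exponent_pow :: "('v \<Rightarrow>\<^sub>0 nat) set \<Rightarrow> nat \<Rightarrow> ('v \<Rightarrow>\<^sub>0 nat) set" where
  "exponent_pow U 0 = UNIV"
| "exponent_pow U (Suc m) = exponent_pow U m + U"

lemma upclosed_exponent_pow: "upclosed (exponent_pow U m)"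
proof (induction m)
  case 0
  show ?case
    by (simp add: upclosed_def)
next
  case (Suc m)
  then show ?case
    by (simp add: upclosed_plus)
qed

lemma exponent_pow_add:
  assumes "a \<in> exponent_pow U m" "b \<in> exponent_pow U n"
  shows "a + b \<in> exponent_pow U (m + n)"
  using assms(2)
proof (induction n arbitrary: b)
  case 0
  show ?case
    using assms(1) upclosed_exponent_pow[of U m] by (simp add: upclosed_def add.commute)
next
  case (Suc n)
  then obtain c d where "b = c + d" "c \<in> exponent_pow U n" "d \<in> U"
    by (auto elim: set_plus_elim)
  then show ?case
    using Suc.IH[of c] by (auto simp: add.assoc[symmetric] intro: set_plus_intro)
qed

lemma subset_exponent_pow_1: "U \<subseteq> exponent_pow U 1"
  using set_zero_plus2[of UNIV U] by simp

lemma ideal_pow_mon_ideal: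
  "ideal_pow (mon_ideal U :: ('v, 'k::comm_ring_1) mpoly set) m = mon_ideal (exponent_pow U m)"
proof (induction m)
  case 0
  show ?case
    by (simp add: mon_ideal_def)
next
  case (Suc m)
  then show ?case
    by (simp add: ideal_prod_mon_ideal upclosed_exponent_pow)
qed

lemma lookup_mult_unique_pair:
  fixes f g :: "('v, 'k::comm_ring_1) mpoly"
  assumes "\<And>a' b'. a' \<in> keys f \<Longrightarrow> b' \<in> keys g \<Longrightarrow> a' + b' = a + b \<Longrightarrow> a' = a \<and> b' = b"
  shows "lookup (f * g) (a + b) = lookup f a * lookup g b"
proof -
  have "lookup f l * (\<Sum>q. lookup g q when a + b = l + q) = (lookup f a * lookup g b when l = a)" for l
  proof (cases "lookup f l = 0")
    case True
    then show ?thesis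
      by (auto simp: when_def)
  next
    case False
    have "(\<lambda>q. lookup g q when a + b = l + q) = (\<lambda>q. (lookup g q when l = a) when q = b)"
      using assms[of l] False by (fastforce simp: fun_eq_iff when_def in_keys_iff)
    then have "(\<Sum>q. lookup g q when a + b = l + q) = (lookup g b when l = a)"
      by (simp only: Sum_any_when_equal)
    then show ?thesis
      by (simp add: when_def)
  qed
  then show ?thesis
    by (simp add: lookup_mult)
qed

lemma mult_single_in_mon_ideal_iff:
  fixes g :: "('v, 'k::comm_ring_1) mpoly"
  shows "g * single a 1 \<in> mon_ideal U \<longleftrightarrow> g \<in> mon_ideal {b. b + a \<in> U}"
proof -
  have "lookup (g * single a 1) (b + a) = lookup g b" for b
    by (subst lookup_mult_unique_pair) (auto simp: lookup_single)
  then have "keys (g * single a 1) = (\<lambda>b. b + a) ` keys g"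
    using keys_mult[of g "single a 1"] by (auto simp: in_keys_iff split: if_splits)
  then show ?thesis
    by (auto simp: mon_ideal_def)
qed

section \<open>The degree in a set of variables\<close>

definition degree_in :: "'v set \<Rightarrow> ('v \<Rightarrow>\<^sub>0 nat) \<Rightarrow> nat" where
  "degree_in A a = (\<Sum>v\<in>A. lookup a v)"

definition degree_ideal :: "'v set \<Rightarrow> nat \<Rightarrow> ('v, 'k::comm_ring_1) mpoly set" where
  "degree_ideal A t = mon_ideal {a. t \<le> degree_in A a}"

lemma degree_in_plus: "degree_in A (a + b) = degree_in A a + degree_in A b"
  by (simp add: degree_in_def lookup_add sum.distrib)

lemma degree_in_single: "finite A \<Longrightarrow> degree_in A (single v n) = (if v \<in> A then n else 0)"
  by (simp add: degree_in_def lookup_single when_def)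

lemma degree_in_ge_1E:
  assumes "1 \<le> degree_in A a"
  obtains v b where "v \<in> A" "a = b + single v 1"
proof -
  obtain v where "v \<in> A" "lookup a v > 0"
    using assms unfolding degree_in_def by (metis not_gr_zero not_one_le_zero sum.neutral)
  then have "a = (a - single v 1) + single v 1"
    by (intro poly_mapping_eqI) (auto simp: lookup_add lookup_minus lookup_single when_def)
  then show thesis
    using \<open>v \<in> A\<close> that by blast
qed

lemma degree_in_exponent_pow_ge:
  assumes degree_ge: "\<And>b. b \<in> U \<Longrightarrow> t \<le> degree_in A b" and "a \<in> exponent_pow U m"
  shows "m * t \<le> degree_in A a"
  using assms(2)
proof (induction m arbitrary: a)
  case (Suc m)
  then obtain b c where "a = b + c" "b \<in> exponent_pow U m" "c \<in> U"
    by (auto elim: set_plus_elim)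
  then show ?case
    using Suc.IH[of b] degree_ge[of c] by (simp add: degree_in_plus)
qed simp

lemma is_ideal_degree_ideal: "is_ideal (degree_ideal A t)"
  unfolding degree_ideal_def by (rule is_ideal_mon_ideal) (simp add: upclosed_def degree_in_plus)

lemma mon_ideal_degree_bounds:
  "mon_ideal {a. \<forall>A\<in>\<A>. t A \<le> degree_in A a} = (\<Inter>A\<in>\<A>. degree_ideal A (t A))"
  by (auto simp: mon_ideal_def degree_ideal_def)

abbreviation var_prime :: "'v set \<Rightarrow> ('v, 'k::comm_ring_1) mpoly set" where
  "var_prime A \<equiv> ideal_gen (var ` A)"

lemma var_prime_eq_degree_ideal:
  assumes "finite A"
  shows "var_prime A = (degree_ideal A 1 :: ('v, 'k::comm_ring_1) mpoly set)"
proof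
  show "var_prime A \<subseteq> (degree_ideal A 1 :: ('v, 'k) mpoly set)"
    by (rule ideal_gen_minimal[OF is_ideal_degree_ideal])
      (auto simp: degree_ideal_def var_def degree_in_single assms)
  show "(degree_ideal A 1 :: ('v, 'k) mpoly set) \<subseteq> var_prime A"
    unfolding degree_ideal_def
  proof (rule mon_ideal_subset_ideal[OF is_ideal_ideal_gen])
    fix a assume "a \<in> {a. 1 \<le> degree_in A a}"
    then have "1 \<le> degree_in A a"
      by simp
    then obtain v b where v: "v \<in> A" and a_eq: "a = b + single v 1"
      by (rule degree_in_ge_1E)
    have "single b 1 * var v \<in> (var_prime A :: ('v, 'k) mpoly set)"
      using v subset_ideal_gen by (intro is_ideal_mult[OF is_ideal_ideal_gen]) blast
    then show "single a (1::'k) \<in> var_prime A"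
      by (simp add: a_eq var_def mult_single)
  qed
qed

lemma var_prime_inject:
  assumes "finite A" "finite B" "var_prime A = (var_prime B :: ('v, 'k::comm_ring_1) mpoly set)"
  shows "A = B"
proof -
  have vars: "{v. var v \<in> (var_prime C :: ('v, 'k) mpoly set)} = C" if "finite C" for C
    unfolding var_prime_eq_degree_ideal[OF that]
    by (simp add: degree_ideal_def var_def degree_in_single that)
  show ?thesis
    using vars[OF assms(1)] vars[OF assms(2)] unfolding assms(3) by simp
qed

text \<open>An injective additive map into the linearly ordered monoid \<open>nat \<Rightarrow>\<^sub>0 nat\<close> turns minimal elements
  into a pair whose sum arises only once.\<close>

lemma ex_unique_sum_pair:
  fixes X Y :: "('v::countable \<Rightarrow>\<^sub>0 nat) set"
  assumes "finite X" "X \<noteq> {}" "finite Y" "Y \<noteq> {}"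
  obtains a b where "a \<in> X" "b \<in> Y"
    "\<And>a' b'. a' \<in> X \<Longrightarrow> b' \<in> Y \<Longrightarrow> a' + b' = a + b \<Longrightarrow> a' = a \<and> b' = b"
proof -
  define h :: "('v \<Rightarrow>\<^sub>0 nat) \<Rightarrow> nat \<Rightarrow>\<^sub>0 nat"
    where "h a = Abs_poly_mapping (\<lambda>n. lookup a (from_nat n) when n \<in> range (to_nat :: 'v \<Rightarrow> nat))" for a
  have finite_support: "finite {n. (lookup a (from_nat n) when n \<in> range (to_nat :: 'v \<Rightarrow> nat)) \<noteq> 0}"
    for a :: "'v \<Rightarrow>\<^sub>0 nat"
    by (rule finite_subset[of _ "to_nat ` keys a"]) (auto simp: when_def in_keys_iff split: if_splits)
  have lookup_h: "lookup (h a) n = (lookup a (from_nat n) when n \<in> range (to_nat :: 'v \<Rightarrow> nat))" for a n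
    unfolding h_def lookup_Abs_poly_mapping[OF finite_support] ..
  have "lookup (h a) (to_nat v) = lookup a v" for a v
    by (simp add: lookup_h)
  then have inj_h: "inj h"
    by (intro injI poly_mapping_eqI) metis
  have h_add: "h (a + b) = h a + h b" for a b
    by (rule poly_mapping_eqI) (simp add: lookup_h lookup_add when_def)
  obtain a b where "is_arg_min h (\<lambda>a. a \<in> X) a" "is_arg_min h (\<lambda>b. b \<in> Y) b"
    using assms ex_is_arg_min_if_finite by metis
  then have "a \<in> X" "b \<in> Y" and h_min: "\<And>a'. a' \<in> X \<Longrightarrow> h a \<le> h a'" "\<And>b'. b' \<in> Y \<Longrightarrow> h b \<le> h b'"
    by (auto simp: is_arg_min_linorder)
  moreover have "a' = a \<and> b' = b" if "a' \<in> X" "b' \<in> Y" "a' + b' = a + b" for a' b'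
  proof -
    have h_sum: "h a' + h b' = h a + h b"
      using that(3) h_add by metis
    then have "h a' = h a"
      using h_min(1)[OF that(1)] h_min(2)[OF that(2)]
      by (metis add_le_cancel_right add_left_mono antisym)
    then show ?thesis
      using h_sum inj_h by (auto simp: inj_eq)
  qed
  ultimately show thesis
    using that by blast
qed

definition low_degree :: "'v set \<Rightarrow> ('v, 'k::zero) mpoly \<Rightarrow> nat" where
  "low_degree A f = Min (degree_in A ` keys f)"

lemma low_degree_le: "a \<in> keys f \<Longrightarrow> low_degree A f \<le> degree_in A a"
  by (simp add: low_degree_def)

lemma low_degree_attained:
  assumes "f \<noteq> 0"
  shows "\<exists>a\<in>keys f. degree_in A a = low_degree A f"
proof -
  have "low_degree A f \<in> degree_in A ` keys f"
    unfolding low_degree_def using assms by (intro Min_in) simp_all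
  then show ?thesis
    by force
qed

lemma low_degree_mult_attained:
  fixes f g :: "('v::countable, 'k::idom) mpoly"
  assumes "f \<noteq> 0" "g \<noteq> 0"
  obtains c where "c \<in> keys (f * g)" "degree_in A c = low_degree A f + low_degree A g"
proof -
  define lowest where "lowest f = {a \<in> keys f. degree_in A a = low_degree A f}"
    for f :: "('v, 'k) mpoly"
  have lowest: "finite (lowest h)" "lowest h \<noteq> {}" if "h \<noteq> 0" for h
    using low_degree_attained[OF that, of A] by (auto simp: lowest_def)
  obtain a b where ab: "a \<in> lowest f" "b \<in> lowest g"
    and unique: "\<And>a' b'. a' \<in> lowest f \<Longrightarrow> b' \<in> lowest g \<Longrightarrow> a' + b' = a + b \<Longrightarrow> a' = a \<and> b' = b"
    using ex_unique_sum_pair[OF lowest[OF assms(1)] lowest[OF assms(2)]] by blast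
  have degree: "degree_in A (a + b) = low_degree A f + low_degree A g"
    using ab by (simp add: lowest_def degree_in_plus)
  have "a' = a \<and> b' = b" if "a' \<in> keys f" "b' \<in> keys g" "a' + b' = a + b" for a' b'
  proof -
    have "degree_in A a' + degree_in A b' = low_degree A f + low_degree A g"
      using degree that(3) degree_in_plus[of A a' b'] by simp
    then have "a' \<in> lowest f" "b' \<in> lowest g"
      using low_degree_le[OF that(1), of A] low_degree_le[OF that(2), of A] that(1,2)
      by (simp_all add: lowest_def)
    then show ?thesis
      using unique that(3) by blast
  qed
  then have "lookup (f * g) (a + b) = lookup f a * lookup g b"
    by (rule lookup_mult_unique_pair)
  then have "a + b \<in> keys (f * g)"
    using ab by (simp add: lowest_def in_keys_iff)
  then show thesis
    using degree by (rule that)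
qed

lemma in_degree_ideal_iff: "f \<in> degree_ideal A t \<longleftrightarrow> f = 0 \<or> t \<le> low_degree A f"
proof (cases "f = 0")
  case False
  then show ?thesis
    using low_degree_attained[OF False, of A] low_degree_le[of _ f A]
    by (fastforce simp: degree_ideal_def mon_ideal_def)
qed (simp add: degree_ideal_def mon_ideal_def)

lemma degree_ideal_primary:
  fixes f g :: "('v::countable, 'k::idom) mpoly"
  assumes "g * f \<in> degree_ideal A t" "f \<notin> degree_ideal A t"
  shows "g \<in> degree_ideal A 1"
proof (rule ccontr)
  assume "g \<notin> degree_ideal A 1"
  then have nonzero: "g \<noteq> 0" "f \<noteq> 0" and low: "low_degree A g + low_degree A f < t"
    using assms(2) by (auto simp: in_degree_ideal_iff)
  obtain c where "c \<in> keys (g * f)" "degree_in A c = low_degree A g + low_degree A f"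
    using low_degree_mult_attained[OF nonzero] .
  then show False
    using assms(1) low by (auto simp: degree_ideal_def mon_ideal_def)
qed

lemma prime_ideal_var_prime:
  assumes "finite A"
  shows "prime_ideal (var_prime A :: ('v::countable, 'k::idom) mpoly set)"
  unfolding prime_ideal_def var_prime_eq_degree_ideal[OF assms]
proof (intro conjI allI impI)
  have "1 \<notin> (degree_ideal A 1 :: ('v, 'k) mpoly set)"
    by (simp add: degree_ideal_def mon_ideal_def degree_in_def)
  then show "(degree_ideal A 1 :: ('v, 'k) mpoly set) \<noteq> UNIV"
    by blast
qed (use is_ideal_degree_ideal degree_ideal_primary in blast)+

lemma var_power: "var v ^ n = single (single v n) 1"
  by (induction n) (simp_all add: var_def mult_single single_add[symmetric])

lemma Ass_degree_ideal_subset: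
  assumes "finite A"
  shows "Ass (degree_ideal A t :: ('v::countable, 'k::idom) mpoly set) \<subseteq> {var_prime A}"
proof (rule Ass_primary_subset)
  fix f g :: "('v, 'k) mpoly" assume "g * f \<in> degree_ideal A t" "f \<notin> degree_ideal A t"
  then show "g \<in> var_prime A"
    unfolding var_prime_eq_degree_ideal[OF assms] by (rule degree_ideal_primary)
next
  fix x :: "('v, 'k) mpoly" assume "x \<in> var ` A"
  then obtain v where "v \<in> A" "x = var v"
    by blast
  then have "x ^ t \<in> degree_ideal A t"
    by (simp add: degree_ideal_def var_power degree_in_single assms)
  then show "\<exists>n. x ^ n \<in> degree_ideal A t" ..
qed (rule is_ideal_degree_ideal)

lemma Ass_degree_bounds_subset:
  assumes "finite \<A>" "\<And>A. A \<in> \<A> \<Longrightarrow> finite A"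
  shows "Ass (mon_ideal {a. \<forall>A\<in>\<A>. t A \<le> degree_in A a} :: ('v::countable, 'k::idom) mpoly set)
    \<subseteq> var_prime ` \<A>"
proof -
  have "Ass (\<Inter>A\<in>\<A>. degree_ideal A (t A) :: ('v, 'k) mpoly set) \<subseteq> (\<Union>A\<in>\<A>. Ass (degree_ideal A (t A)))"
    using assms(1) is_ideal_degree_ideal by (rule Ass_INT_subset)
  also have "\<dots> \<subseteq> var_prime ` \<A>"
    using Ass_degree_ideal_subset[OF assms(2)] by fast
  finally show ?thesis
    unfolding mon_ideal_degree_bounds .
qed

lemma var_prime_in_AssI:
  assumes "finite A" "\<And>b. b + a \<in> U \<longleftrightarrow> 1 \<le> degree_in A b"
  shows "var_prime A \<in> Ass (mon_ideal U :: ('v::countable, 'k::idom) mpoly set)"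
proof -
  have "var_prime A = colon (mon_ideal U :: ('v, 'k) mpoly set) (single a 1)"
    unfolding var_prime_eq_degree_ideal[OF assms(1)] degree_ideal_def colon_def
      mult_single_in_mon_ideal_iff assms(2) by simp
  then show ?thesis
    unfolding Ass_def using prime_ideal_var_prime[OF assms(1)] by blast
qed

text \<open>The monomial of \<open>a\<close> lies outside the \<open>n\<close>-th power, but its product with any variable of \<open>A\<close> lies
  inside. Multiplication by elements of minimal \<open>A\<close>-degree carries this over to the higher powers.\<close>

lemma var_prime_in_Ass_pow:
  assumes "finite A" and degree_ge: "\<And>b. b \<in> U \<Longrightarrow> t \<le> degree_in A b"
    and minimal: "c \<in> U" "degree_in A c = t"
    and below: "Suc (degree_in A a) = n * t" and enters: "\<And>v. v \<in> A \<Longrightarrow> single v 1 + a \<in> exponent_pow U n"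
    and "n \<le> m"
  shows "var_prime A \<in> Ass (ideal_pow (mon_ideal U :: ('v::countable, 'k::idom) mpoly set) m)"
proof -
  have "\<exists>a. Suc (degree_in A a) = m * t \<and> (\<forall>v\<in>A. single v 1 + a \<in> exponent_pow U m)"
    using \<open>n \<le> m\<close>
  proof (induction m rule: dec_induct)
    case base
    show ?case
      using below enters by blast
  next
    case (step m)
    then obtain a where "Suc (degree_in A a) = m * t" "\<forall>v\<in>A. single v 1 + a \<in> exponent_pow U m"
      by blast
    then show ?case
      using minimal by (intro exI[of _ "a + c"])
        (auto simp: degree_in_plus add.assoc[symmetric] intro: set_plus_intro)
  qed
  then obtain a where a_below: "Suc (degree_in A a) = m * t"
    and a_enters: "\<And>v. v \<in> A \<Longrightarrow> single v 1 + a \<in> exponent_pow U m"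
    by blast
  show ?thesis
    unfolding ideal_pow_mon_ideal
  proof (rule var_prime_in_AssI[OF \<open>finite A\<close>], rule iffI)
    fix b assume "b + a \<in> exponent_pow U m"
    then show "1 \<le> degree_in A b"
      using degree_in_exponent_pow_ge[OF degree_ge] a_below by (fastforce simp: degree_in_plus)
  next
    fix b assume "1 \<le> degree_in A b"
    then obtain v b' where "v \<in> A" "b = b' + single v 1"
      by (rule degree_in_ge_1E)
    then show "b + a \<in> exponent_pow U m"
      using a_enters upclosed_exponent_pow[of U m] by (simp add: upclosed_def add.assoc)
  qed
qed

section \<open>Weighted covers and odd closed walks\<close>

lemma simple_graph_sym: "simple_graph E \<Longrightarrow> E u v \<Longrightarrow> E v u"
  by (simp add: simple_graph_def)

lemma simple_graph_irrefl: "simple_graph E \<Longrightarrow> \<not> E u u"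
  by (simp add: simple_graph_def)

definition order_cover :: "('v \<Rightarrow> 'v \<Rightarrow> bool) \<Rightarrow> nat \<Rightarrow> ('v \<Rightarrow> nat) \<Rightarrow> bool" where
  "order_cover E m w \<longleftrightarrow> (\<forall>u v. E u v \<longrightarrow> m \<le> w u + w v)"

lemma order_coverD: "order_cover E m w \<Longrightarrow> E u v \<Longrightarrow> m \<le> w u + w v"
  by (simp add: order_cover_def)

lemma order_cover_sum_walk:
  assumes cover: "order_cover E m w" and walk: "\<And>i. Suc i < j + 2 * n \<Longrightarrow> E (F i) (F (Suc i))"
  shows "(\<Sum>i<j. w (F i)) + m * n \<le> (\<Sum>i<j + 2 * n. w (F i))"
  using walk
proof (induction n)
  case (Suc n)
  have "m \<le> w (F (j + 2 * n)) + w (F (Suc (j + 2 * n)))"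
    using Suc.prems by (intro order_coverD[OF cover]) simp
  with Suc show ?case
    by simp
qed simp

definition closed_walk :: "('v \<Rightarrow> 'v \<Rightarrow> bool) \<Rightarrow> (nat \<Rightarrow> 'v) \<Rightarrow> nat \<Rightarrow> bool" where
  "closed_walk E F k \<longleftrightarrow> (\<forall>i. E (F i) (F (Suc i))) \<and> (\<forall>i. F (i + k) = F i)"

lemma closed_walk_mod:
  assumes "closed_walk E F k"
  shows "F (i mod k) = F i"
proof -
  have "F (j + n * k) = F j" for j n
  proof (induction n)
    case (Suc n)
    have "j + Suc n * k = (j + n * k) + k"
      by simp
    with Suc assms show ?case
      unfolding closed_walk_def by metis
  qed simp
  then show ?thesis
    by (metis mod_div_mult_eq)
qed

lemma sum_closed_walk_shift:
  fixes w :: "'v \<Rightarrow> nat"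
  assumes "closed_walk E F k"
  shows "(\<Sum>i<k. w (F (s + i))) = (\<Sum>i<k. w (F i))"
proof (induction s)
  case (Suc s)
  have "w (F s) + (\<Sum>i<k. w (F (Suc s + i))) = (\<Sum>i<Suc k. w (F (s + i)))"
    by (subst sum.lessThan_Suc_shift) simp
  also have "\<dots> = (\<Sum>i<k. w (F (s + i))) + w (F s)"
    using assms by (simp add: closed_walk_def)
  finally show ?case
    using Suc by simp
qed simp

lemma closed_walk_mod_Suc:
  assumes walk: "\<And>i. i < n \<Longrightarrow> E (f i) (f (Suc i))" and close: "E (f n) (f 0)"
  shows "closed_walk E (\<lambda>i. f (i mod Suc n)) (Suc n)"
  unfolding closed_walk_def
proof (intro conjI allI)
  fix i show "E (f (i mod Suc n)) (f (Suc i mod Suc n))"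
  proof (cases "i mod Suc n = n")
    case True
    then show ?thesis
      using close by (simp add: mod_Suc)
  next
    case False
    then have "i mod Suc n < n"
      by (metis less_SucE mod_less_divisor zero_less_Suc)
    then show ?thesis
      using walk by (simp add: mod_Suc)
  qed
  show "f ((i + Suc n) mod Suc n) = f (i mod Suc n)"
    by (simp only: mod_add_self2)
qed

lemma order_cover_sum_closed_walk:
  assumes cover: "order_cover E m w" and closed: "closed_walk E F k"
  shows "m * k \<le> 2 * (\<Sum>i<k. w (F i))"
proof -
  have "m * k = (\<Sum>i<k. m)"
    by simp
  also have "\<dots> \<le> (\<Sum>i<k. w (F i) + w (F (1 + i)))"
    using closed by (intro sum_mono order_coverD[OF cover]) (simp add: closed_walk_def)
  also have "\<dots> = 2 * (\<Sum>i<k. w (F i))"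
    using sum_closed_walk_shift[OF closed, of w 1] by (simp add: sum.distrib)
  finally show ?thesis .
qed

text \<open>A chord from \<open>F i\<close> to \<open>F (i + d)\<close> with \<open>d\<close> even closes up the \<open>d + 1\<close> vertices in between
  to a shorter odd walk; on an odd closed walk every chord is of this form in one of its two orientations.\<close>

definition no_odd_chord :: "('v \<Rightarrow> 'v \<Rightarrow> bool) \<Rightarrow> (nat \<Rightarrow> 'v) \<Rightarrow> nat \<Rightarrow> bool" where
  "no_odd_chord E F k \<longleftrightarrow> (\<forall>i d. even d \<longrightarrow> Suc d < k \<longrightarrow> \<not> E (F (i + d)) (F i))"

lemma no_odd_chord_inj_on:
  assumes closed: "closed_walk E F k" and "odd k" and chordless: "no_odd_chord E F k"
  shows "inj_on F {..<k}"
proof (rule linorder_inj_onI)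
  fix i j assume ij: "i < j" "i \<in> {..<k}" "j \<in> {..<k}"
  show "F i \<noteq> F j"
  proof
    assume "F i = F j"
    show False
    proof (cases "even (j - i)")
      case True
      define d where "d = i + k - Suc j"
      have "Suc j + d = i + k" "Suc d < k" "even d"
        using ij True \<open>odd k\<close> by (auto simp: d_def)
      then have "\<not> E (F (i + k)) (F (Suc j))"
        using chordless unfolding no_odd_chord_def by metis
      then show False
        using closed \<open>F i = F j\<close> by (simp add: closed_walk_def)
    next
      case False
      then have "\<not> E (F j) (F (Suc i))"
        using chordless[unfolded no_odd_chord_def, rule_format, of "j - Suc i" "Suc i"] ij by simp
      then show False
        using closed \<open>F i = F j\<close> unfolding closed_walk_def by metis
    qed
  qed
qed auto

lemma no_odd_chord_adjacent:
  assumes closed: "closed_walk E F k" and "odd k" and chordless: "no_odd_chord E F k"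
    and adjacent: "E (F i) (F j)" "E (F j) (F i)" and "i < j" "j < k"
  shows "j = Suc i \<or> i = 0 \<and> Suc j = k"
proof (cases "even (j - i)")
  case True
  then have "\<not> Suc (j - i) < k"
    using chordless[unfolded no_odd_chord_def, rule_format, of "j - i" i] adjacent \<open>i < j\<close> by auto
  then show ?thesis
    using \<open>i < j\<close> \<open>j < k\<close> by linarith
next
  case False
  then have "even (i + k - j)"
    using \<open>i < j\<close> \<open>j < k\<close> \<open>odd k\<close> by auto
  moreover have "F (j + (i + k - j)) = F i"
    using closed \<open>j < k\<close> by (simp add: closed_walk_def)
  ultimately have "\<not> Suc (i + k - j) < k"
    using chordless[unfolded no_odd_chord_def, rule_format, of "i + k - j" j] adjacent by auto
  then show ?thesis
    using \<open>i < j\<close> \<open>j < k\<close> by linarith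
qed

lemma no_odd_chord_induced_odd_cycle:
  assumes simple: "simple_graph E" and closed: "closed_walk E F k" and "odd k"
    and chordless: "no_odd_chord E F k"
  shows "induced_odd_cycle E (F ` {..<k})"
proof -
  have steps: "E (F i) (F (Suc i))" for i
    using closed by (simp add: closed_walk_def)
  have "k \<noteq> 1"
    using closed steps[of 0] simple_graph_irrefl[OF simple, of "F 0"] by (auto simp: closed_walk_def)
  then have "k \<ge> 3"
    using \<open>odd k\<close> by presburger
  have adjacent_less: "j = Suc i mod k \<or> i = Suc j mod k" if "E (F i) (F j)" "i < j" "j < k" for i j
    using no_odd_chord_adjacent[OF closed \<open>odd k\<close> chordless that(1) simple_graph_sym[OF simple that(1)]]
      that(2,3) by auto
  have "E (F i) (F j) \<longleftrightarrow> j = Suc i mod k \<or> i = Suc j mod k" if "i < k" "j < k" for i j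
  proof
    assume "j = Suc i mod k \<or> i = Suc j mod k"
    then show "E (F i) (F j)"
      using closed_walk_mod[OF closed] steps simple_graph_sym[OF simple] by metis
  next
    assume adjacent: "E (F i) (F j)"
    then have "i \<noteq> j"
      using simple_graph_irrefl[OF simple] by metis
    then show "j = Suc i mod k \<or> i = Suc j mod k"
      using adjacent_less[OF adjacent] adjacent_less[OF simple_graph_sym[OF simple adjacent]] that
      by (meson nat_neq_iff)
  qed
  then show ?thesis
    unfolding induced_odd_cycle_def
    using \<open>odd k\<close> \<open>k \<ge> 3\<close> no_odd_chord_inj_on[OF closed \<open>odd k\<close> chordless] inj_on_imp_bij_betw
    by blast
qed

text \<open>A chord splits an odd closed walk into a shorter one and a path on an even number of vertices;
  the latter is covered by disjoint edges.\<close>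

lemma order_cover_sum_odd_closed_walk:
  assumes simple: "simple_graph E" and cover: "order_cover E m w"
    and cycles: "\<And>S. induced_odd_cycle E S \<Longrightarrow> m * ((card S + 1) div 2) \<le> sum w S"
    and "closed_walk E F k" "odd k"
  shows "m * ((k + 1) div 2) \<le> (\<Sum>i<k. w (F i))"
  using assms(4,5)
proof (induction k arbitrary: F rule: less_induct)
  case (less k)
  show ?case
  proof (cases "no_odd_chord E F k")
    case True
    have "inj_on F {..<k}"
      by (rule no_odd_chord_inj_on[OF less.prems True])
    then show ?thesis
      using cycles[OF no_odd_chord_induced_odd_cycle[OF simple less.prems True]]
      by (simp add: card_image sum.reindex)
  next
    case False
    then obtain s d where chord: "even d" "Suc d < k" "E (F (s + d)) (F s)"
      by (auto simp: no_odd_chord_def)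
    define f where "f i = F (s + i)" for i
    define n where "n = (k - Suc d) div 2"
    have k_eq: "k = Suc d + 2 * n"
      using chord less.prems(2) by (auto simp: n_def)
    have steps: "E (f i) (f (Suc i))" for i
      using less.prems(1) by (simp add: f_def closed_walk_def)
    then have "closed_walk E (\<lambda>i. f (i mod Suc d)) (Suc d)"
      using chord(3) by (intro closed_walk_mod_Suc) (simp_all add: f_def)
    then have "m * ((Suc d + 1) div 2) \<le> (\<Sum>i<Suc d. w (f (i mod Suc d)))"
      using chord by (intro less.IH) simp_all
    then have "m * ((k + 1) div 2) \<le> (\<Sum>i<Suc d. w (f i)) + m * n"
      using chord(1) by (simp add: k_eq algebra_simps)
    also have "\<dots> \<le> (\<Sum>i<k. w (f i))"
      unfolding k_eq using steps by (intro order_cover_sum_walk[OF cover])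
    also have "\<dots> = (\<Sum>i<k. w (F i))"
      unfolding f_def by (rule sum_closed_walk_shift[OF less.prems(1)])
    finally show ?thesis .
  qed
qed

section \<open>Bipartite graphs\<close>

lemma symp_relpowp:
  assumes "symp E"
  shows "symp (E ^^ n)"
proof (rule sympI)
  show "(E ^^ n) v u" if "(E ^^ n) u v" for u v
    using that
  proof (induction n arbitrary: v)
    case (Suc n)
    then show ?case
      using assms relpowp_Suc_I2[of E v _ n u] by (auto dest: sympD)
  qed simp
qed

lemma relpowp_closed_walk:
  assumes "(E ^^ Suc n) u u"
  shows "\<exists>F. closed_walk E F (Suc n)"
proof -
  obtain f where "f 0 = u" "f (Suc n) = u" "\<forall>i<Suc n. E (f i) (f (Suc i))"
    using assms unfolding relpowp_fun_conv by blast
  then have "closed_walk E (\<lambda>i. f (i mod Suc n)) (Suc n)"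
    by (intro closed_walk_mod_Suc) (auto dest: spec[of _ n])
  then show ?thesis
    by blast
qed

lemma relpowp_parity_unique:
  assumes "symp E" "\<And>n u. odd n \<Longrightarrow> \<not> (E ^^ n) u u" "(E ^^ i) u v" "(E ^^ j) u v"
  shows "even i \<longleftrightarrow> even j"
proof -
  have "(E ^^ (i + j)) u u"
    using relpowp_trans[OF assms(3)] sympD[OF symp_relpowp[OF assms(1)] assms(4)] by blast
  then show ?thesis
    using assms(2) even_add by blast
qed

lemma bipartite_if_no_odd_closed_relpowp:
  assumes "symp E" and no_odd: "\<And>n u. odd n \<Longrightarrow> \<not> (E ^^ n) u u"
  shows "bipartite E"
proof -
  define root where "root u = (SOME z. E\<^sup>*\<^sup>* z u)" for u
  have root: "E\<^sup>*\<^sup>* (root u) u" for u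
    unfolding root_def by (rule someI[of _ u]) simp
  have root_eq: "root u = root v" if "E u v" for u v
  proof -
    have "E\<^sup>*\<^sup>* z u \<longleftrightarrow> E\<^sup>*\<^sup>* z v" for z
      using that assms(1) by (meson rtranclp.rtrancl_into_rtrancl sympD)
    then show ?thesis
      by (simp add: root_def)
  qed
  define colour where "colour u \<longleftrightarrow> (\<exists>n. even n \<and> (E ^^ n) (root u) u)" for u
  have colour_iff: "colour u \<longleftrightarrow> even n" if "(E ^^ n) (root u) u" for u n
    unfolding colour_def using that relpowp_parity_unique[OF assms that] by blast
  have "colour u \<noteq> colour v" if "E u v" for u v
  proof -
    obtain n where walk: "(E ^^ n) (root u) u"
      using rtranclp_imp_relpowp[OF root] by blast
    have "(E ^^ Suc n) (root v) v"
      using relpowp_Suc_I[OF walk \<open>E u v\<close>] root_eq[OF \<open>E u v\<close>] by simp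
    then show ?thesis
      using colour_iff[OF walk] colour_iff[of "Suc n" v] by simp
  qed
  then show ?thesis
    unfolding bipartite_def by blast
qed

text \<open>Without induced odd cycles the constant weight 1, a cover of order 2, would have total weight
  at least \<open>k + 1\<close> on any closed walk of odd length \<open>k\<close>.\<close>

lemma bipartite_if_no_induced_odd_cycle:
  assumes simple: "simple_graph E" and no_cycle: "\<And>S. \<not> induced_odd_cycle E S"
  shows "bipartite E"
proof (rule bipartite_if_no_odd_closed_relpowp)
  show "symp E"
    using simple_graph_sym[OF simple] by (rule sympI)
  fix k :: nat and u assume "odd k"
  show "\<not> (E ^^ k) u u"
  proof
    assume "(E ^^ k) u u"
    then obtain F where "closed_walk E F k"
      using \<open>odd k\<close> relpowp_closed_walk[of "k - 1" E u] by (auto elim: oddE)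
    then have "2 * ((k + 1) div 2) \<le> (\<Sum>i<k. 1)"
      using no_cycle \<open>odd k\<close>
      by (intro order_cover_sum_odd_closed_walk[OF simple]) (auto simp: order_cover_def)
    then show False
      using \<open>odd k\<close> by simp
  qed
qed

definition delete_vertex :: "('v \<Rightarrow> 'v \<Rightarrow> bool) \<Rightarrow> 'v \<Rightarrow> 'v \<Rightarrow> 'v \<Rightarrow> bool" where
  "delete_vertex E v x y \<longleftrightarrow> E x y \<and> x \<noteq> v \<and> y \<noteq> v"

lemma simple_graph_delete_vertex: "simple_graph E \<Longrightarrow> simple_graph (delete_vertex E v)"
  by (simp add: simple_graph_def delete_vertex_def)

lemma induced_odd_cycle_delete_vertexD:
  assumes "induced_odd_cycle (delete_vertex E v) S"
  shows "induced_odd_cycle E S" "v \<notin> S"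
proof -
  obtain k f where k: "odd k" "k \<ge> 3" and bij: "bij_betw f {..<k} S"
    and adjacent: "\<And>i j. i < k \<Longrightarrow> j < k \<Longrightarrow>
      delete_vertex E v (f i) (f j) \<longleftrightarrow> j = Suc i mod k \<or> i = Suc j mod k"
    using assms unfolding induced_odd_cycle_def by blast
  have not_v: "f i \<noteq> v" if "i < k" for i
    using adjacent[of i "Suc i mod k"] that by (auto simp: delete_vertex_def)
  then show "v \<notin> S"
    using bij by (auto simp: bij_betw_def)
  have "E (f i) (f j) \<longleftrightarrow> j = Suc i mod k \<or> i = Suc j mod k" if "i < k" "j < k" for i j
    using adjacent[OF that] not_v that by (simp add: delete_vertex_def)
  then show "induced_odd_cycle E S"
    unfolding induced_odd_cycle_def using k bij by blast
qed

lemma bipartite_delete_vertex: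
  assumes "simple_graph E" "\<And>S. induced_odd_cycle E S \<Longrightarrow> v \<in> S"
  shows "bipartite (delete_vertex E v)"
proof (rule bipartite_if_no_induced_odd_cycle)
  show "simple_graph (delete_vertex E v)"
    using assms(1) by (rule simple_graph_delete_vertex)
  show "\<not> induced_odd_cycle (delete_vertex E v) S" for S
    using assms(2) induced_odd_cycle_delete_vertexD[of E v S] by blast
qed

section \<open>Induced odd cycles\<close>

definition independent :: "('v \<Rightarrow> 'v \<Rightarrow> bool) \<Rightarrow> 'v set \<Rightarrow> bool" where
  "independent E T \<longleftrightarrow> (\<forall>u\<in>T. \<forall>v\<in>T. \<not> E u v)"

definition odd_cycle_enum :: "('v \<Rightarrow> 'v \<Rightarrow> bool) \<Rightarrow> 'v set \<Rightarrow> (nat \<Rightarrow> 'v) \<Rightarrow> nat \<Rightarrow> bool" where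
  "odd_cycle_enum E S F k \<longleftrightarrow> odd k \<and> k \<ge> 3 \<and> range F = S \<and>
    (\<forall>i j. F i = F j \<longleftrightarrow> [i = j] (mod k)) \<and>
    (\<forall>i j. E (F i) (F j) \<longleftrightarrow> [j = Suc i] (mod k) \<or> [i = Suc j] (mod k))"

lemma induced_odd_cycle_enum:
  assumes "induced_odd_cycle E S"
  shows "\<exists>F k. odd_cycle_enum E S F k"
proof -
  obtain k f where k: "odd k" "k \<ge> 3" and bij: "bij_betw f {..<k} S"
    and adjacent: "\<And>i j. i < k \<Longrightarrow> j < k \<Longrightarrow> E (f i) (f j) \<longleftrightarrow> j = Suc i mod k \<or> i = Suc j mod k"
    using assms unfolding induced_odd_cycle_def by blast
  define F where "F i = f (i mod k)" for i
  have in_range: "i mod k < k" for i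
    using k(2) by simp
  have "range F = f ` {..<k}"
    unfolding F_def using in_range by (auto simp: image_iff) (metis mod_less)
  moreover have "F i = F j \<longleftrightarrow> [i = j] (mod k)" for i j
    using bij in_range by (auto simp: F_def cong_def bij_betw_def dest: inj_onD)
  moreover have "E (F i) (F j) \<longleftrightarrow> [j = Suc i] (mod k) \<or> [i = Suc j] (mod k)" for i j
    unfolding F_def cong_def adjacent[OF in_range in_range] by (simp add: mod_Suc_eq)
  ultimately show ?thesis
    unfolding odd_cycle_enum_def using k bij by (auto simp: bij_betw_def)
qed

lemma odd_cycle_enum_shift:
  assumes enum: "odd_cycle_enum E S F k"
  shows "odd_cycle_enum E S (\<lambda>i. F (s + i)) k"
proof -
  have "F j \<in> range (\<lambda>i. F (s + i))" for j
  proof -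
    have "s + (j + s * (k - 1)) = j + s * k"
      using enum by (cases k) (simp_all add: odd_cycle_enum_def)
    then have "[s + (j + s * (k - 1)) = j] (mod k)"
      by (metis cong_def mod_mult_self1)
    then have "F (s + (j + s * (k - 1))) = F j"
      using enum unfolding odd_cycle_enum_def by blast
    then show ?thesis
      by (metis rangeI)
  qed
  then have "range (\<lambda>i. F (s + i)) = range F"
    by blast
  then show ?thesis
    using enum cong_add_lcancel_nat[of s] unfolding odd_cycle_enum_def by (simp flip: add_Suc_right)
qed

lemma odd_cycle_enum_from:
  assumes "induced_odd_cycle E S" "v \<in> S"
  obtains F k where "odd_cycle_enum E S F k" "F 0 = v"
proof -
  obtain F k where enum: "odd_cycle_enum E S F k"
    using induced_odd_cycle_enum[OF assms(1)] by blast
  then obtain s where "v = F s"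
    using assms(2) by (auto simp: odd_cycle_enum_def)
  then show thesis
    using that[OF odd_cycle_enum_shift[OF enum, of s]] by simp
qed

lemma bij_betw_odd_cycle_enum:
  assumes enum: "odd_cycle_enum E S F k"
  shows "bij_betw F {..<k} S"
proof -
  have "inj_on F {..<k}"
    using enum by (auto simp: odd_cycle_enum_def intro!: inj_onI dest: cong_less_modulus_unique_nat)
  moreover have "F j \<in> F ` {..<k}" for j
  proof -
    have "F j = F (j mod k)" "j mod k < k"
      using enum by (auto simp: odd_cycle_enum_def cong_def)
    then show ?thesis
      by blast
  qed
  ultimately show ?thesis
    using enum by (auto simp: bij_betw_def odd_cycle_enum_def)
qed

lemma closed_walk_odd_cycle_enum: "odd_cycle_enum E S F k \<Longrightarrow> closed_walk E F k"
  by (simp add: odd_cycle_enum_def closed_walk_def cong_def)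

lemma card_odd_cycle_enum: "odd_cycle_enum E S F k \<Longrightarrow> card S = k"
  using bij_betw_same_card[OF bij_betw_odd_cycle_enum] by fastforce

lemma induced_odd_cycle_card:
  assumes "induced_odd_cycle E S"
  shows "odd (card S)" "card S \<ge> 3"
  using induced_odd_cycle_enum[OF assms] by (auto simp: card_odd_cycle_enum odd_cycle_enum_def)

lemma order_cover_sum_induced_odd_cycle:
  assumes cover: "order_cover E m w" and cycle: "induced_odd_cycle E S"
  shows "m * card S \<le> 2 * sum w S"
proof -
  obtain F k where enum: "odd_cycle_enum E S F k"
    using induced_odd_cycle_enum[OF cycle] by blast
  show ?thesis
    using order_cover_sum_closed_walk[OF cover closed_walk_odd_cycle_enum[OF enum]]
      sum.reindex_bij_betw[OF bij_betw_odd_cycle_enum[OF enum], of w] card_odd_cycle_enum[OF enum]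
    by simp
qed

lemma independent_odd_cycle_enum_parity:
  assumes enum: "odd_cycle_enum E S F k"
  shows "independent E (F ` {i \<in> {0<..<k}. even i \<longleftrightarrow> b})"
  unfolding independent_def
proof (intro ballI notI)
  have cong_SucD: "j = Suc i" if "[j = Suc i] (mod k)" "i < k" "0 < j" "j < k" for i j
    using that by (auto simp: cong_def mod_Suc split: if_splits)
  fix u v assume "u \<in> F ` {i \<in> {0<..<k}. even i \<longleftrightarrow> b}" "v \<in> F ` {i \<in> {0<..<k}. even i \<longleftrightarrow> b}" "E u v"
  then obtain i j where "i \<in> {0<..<k}" "j \<in> {0<..<k}" "even i \<longleftrightarrow> even j" "E (F i) (F j)"
    by auto
  then have "j = Suc i \<or> i = Suc j"
    using enum cong_SucD[of j i] cong_SucD[of i j] by (auto simp: odd_cycle_enum_def)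
  then show False
    using \<open>even i \<longleftrightarrow> even j\<close> by auto
qed

lemma induced_odd_cycle_minus_vertex:
  assumes "induced_odd_cycle E S" "v \<in> S"
  obtains T0 T1 where "independent E T0" "independent E T1" "T0 \<inter> T1 = {}" "T0 \<union> T1 = S - {v}"
    "card T0 = card S div 2"
proof -
  obtain F k where enum: "odd_cycle_enum E S F k" and "F 0 = v"
    using odd_cycle_enum_from[OF assms] .
  have inj: "inj_on F {..<k}" and image: "F ` {..<k} = S" and "0 < k"
    using bij_betw_odd_cycle_enum[OF enum] enum by (auto simp: bij_betw_def odd_cycle_enum_def)
  define indices where "indices b = {i \<in> {0<..<k}. even i \<longleftrightarrow> b}" for b
  have indices_subset: "indices b \<subseteq> {..<k}" for b
    by (auto simp: indices_def)
  show thesis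
  proof
    show "independent E (F ` indices False)" "independent E (F ` indices True)"
      unfolding indices_def by (rule independent_odd_cycle_enum_parity[OF enum])+
    have "indices False \<inter> indices True = {}"
      by (auto simp: indices_def)
    then show "F ` indices False \<inter> F ` indices True = {}"
      using inj_on_image_Int[OF inj indices_subset indices_subset] by (metis image_empty)
    have "indices False \<union> indices True = {..<k} - {0}"
      by (auto simp: indices_def)
    then have "F ` indices False \<union> F ` indices True = F ` ({..<k} - {0})"
      by (simp flip: image_Un)
    also have "\<dots> = F ` {..<k} - F ` {0}"
      using inj \<open>0 < k\<close> by (intro inj_on_image_set_diff) auto
    finally show "F ` indices False \<union> F ` indices True = S - {v}"
      by (simp add: image \<open>F 0 = v\<close>)
    have "indices False = (\<lambda>j. 2 * j + 1) ` {..<k div 2}"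
      using enum by (auto simp: indices_def odd_cycle_enum_def elim!: oddE)
    then have "card (indices False) = k div 2"
      by (simp add: card_image inj_on_def)
    then show "card (F ` indices False) = card S div 2"
      using card_image[OF inj_on_subset[OF inj indices_subset]] card_odd_cycle_enum[OF enum] by simp
  qed
qed

section \<open>Covers as sums of vertex covers\<close>

lemma order_cover_plus:
  "order_cover E m p \<Longrightarrow> order_cover E n q \<Longrightarrow> order_cover E (m + n) (\<lambda>u. p u + q u)"
  by (fastforce simp: order_cover_def)

definition covers :: "('v \<Rightarrow> 'v \<Rightarrow> bool) \<Rightarrow> nat \<Rightarrow> ('v \<Rightarrow>\<^sub>0 nat) set" where
  "covers E m = {a. order_cover E m (lookup a)}"

lemma exponent_pow_covers_subset: "exponent_pow (covers E 1) m \<subseteq> covers E m"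
proof (induction m)
  case 0
  show ?case
    by (simp add: covers_def order_cover_def)
next
  case (Suc m)
  have "a + b \<in> covers E (Suc m)" if "a \<in> covers E m" "b \<in> covers E 1" for a b :: "'a \<Rightarrow>\<^sub>0 nat"
    using that order_cover_plus[of E m "lookup a" 1 "lookup b"] by (simp add: covers_def plus_poly_mapping.rep_eq)
  with Suc show ?case
    by (auto elim!: set_plus_elim)
qed

definition compl_indicator :: "'v::finite set \<Rightarrow> 'v \<Rightarrow>\<^sub>0 nat" where
  "compl_indicator T = Abs_poly_mapping (\<lambda>u. of_bool (u \<notin> T))"

lemma lookup_compl_indicator: "lookup (compl_indicator T) u = of_bool (u \<notin> T)"
  by (simp add: compl_indicator_def)

lemma compl_indicator_in_covers: "independent E T \<Longrightarrow> compl_indicator T \<in> covers E 1"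
  by (auto simp: covers_def order_cover_def independent_def lookup_compl_indicator)

text \<open>One can split off a vertex cover that takes a vertex of one colour only if its weight is at least
  \<open>m\<close>, and a vertex of the other colour whenever its weight is positive.\<close>

lemma covers_coloured_in_exponent_pow:
  fixes a :: "'v::finite \<Rightarrow>\<^sub>0 nat" and colour :: "'v \<Rightarrow> bool"
  assumes "a \<in> covers E m"
    and "\<And>u v. E u v \<Longrightarrow> lookup a u < m \<Longrightarrow> lookup a v < m \<Longrightarrow> colour u \<noteq> colour v"
  shows "a \<in> exponent_pow (covers E 1) m"
  using assms
proof (induction m arbitrary: a)
  case (Suc m)
  have cover: "Suc m \<le> lookup a u + lookup a v" if "E u v" for u v
    using Suc.prems(1) that by (simp add: covers_def order_cover_def)
  define T where "T = {u. if colour u then lookup a u \<le> m else lookup a u = 0}"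
  define b where "b = compl_indicator T"
  have "a = (a - b) + b"
    by (rule poly_mapping_eqI)
      (auto simp: b_def T_def lookup_add lookup_minus lookup_compl_indicator)
  have lookup_diff: "lookup (a - b) u = lookup a u - of_bool (u \<notin> T)" for u
    by (simp add: b_def lookup_minus lookup_compl_indicator)
  have "a - b \<in> exponent_pow (covers E 1) m"
  proof (rule Suc.IH)
    have "m \<le> lookup (a - b) u + lookup (a - b) v" if "E u v" for u v
      using cover[OF that] Suc.prems(2)[OF that] by (auto simp: lookup_diff T_def split: if_splits)
    then show "a - b \<in> covers E m"
      by (simp add: covers_def order_cover_def)
    show "colour u \<noteq> colour v" if "E u v" "lookup (a - b) u < m" "lookup (a - b) v < m" for u v
      using that Suc.prems(2)[OF that(1)] by (simp add: lookup_diff of_bool_def split: if_splits)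
  qed
  moreover have "independent E T"
    unfolding independent_def
  proof (intro ballI notI)
    fix u v assume "u \<in> T" "v \<in> T" "E u v"
    then show False
      using cover[of u v] Suc.prems(2)[of u v] by (auto simp: T_def split: if_splits)
  qed
  then have "b \<in> covers E 1"
    unfolding b_def by (rule compl_indicator_in_covers)
  ultimately show ?case
    using \<open>a = (a - b) + b\<close> set_plus_intro by fastforce
qed simp

text \<open>Lower bounds on \<open>p\<close> that are forced if \<open>A \<le> p \<le> b\<close> and, on \<open>H\<close>, \<open>p\<close> and \<open>b - p\<close> are covers of
  orders \<open>k\<close> and \<open>n\<close>. On a bipartite graph these are difference constraints, so consistency of the forced
  bounds suffices for a solution: take the least admissible values on one side, the greatest on the other.\<close>

inductive forced_lower ::
  "('v \<Rightarrow> 'v \<Rightarrow> bool) \<Rightarrow> ('v \<Rightarrow> nat) \<Rightarrow> nat \<Rightarrow> nat \<Rightarrow> ('v \<Rightarrow> nat) \<Rightarrow> 'v \<Rightarrow> nat \<Rightarrow> bool"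
  for H b k n A where
  lower: "forced_lower H b k n A x (A x)"
| upper: "H x y \<Longrightarrow> forced_lower H b k n A x (k - b y)"
| step: "forced_lower H b k n A z r \<Longrightarrow> H z y \<Longrightarrow> H y x
    \<Longrightarrow> forced_lower H b k n A x (r + (k + n) - (b y + b z))"

lemma ex_order_cover_split_if_lower:
  fixes b A lo :: "'v \<Rightarrow> nat" and colour :: "'v \<Rightarrow> bool"
  assumes sym: "\<And>x y. H x y \<Longrightarrow> H y x" and colour: "\<And>x y. H x y \<Longrightarrow> colour x \<noteq> colour y"
    and lower: "\<And>x. A x \<le> lo x" and upper: "\<And>x. lo x \<le> b x"
    and nbr: "\<And>x y. H x y \<Longrightarrow> lo x + A y + n \<le> b x + b y"
    and edge: "\<And>x y. H x y \<Longrightarrow> k \<le> lo x + b y"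
    and path: "\<And>x y z. H z y \<Longrightarrow> H y x \<Longrightarrow> lo z + (k + n) \<le> lo x + b y + b z"
  shows "\<exists>p. (\<forall>x. A x \<le> p x \<and> p x \<le> b x) \<and> order_cover H k p \<and> order_cover H n (\<lambda>x. b x - p x)"
proof -
  define up where "up y = Inf (insert (b y) {b x + b y - n - lo x |x. H x y})" for y
  define p where "p x = (if colour x then lo x else up x)" for x
  have up_le: "up y \<le> b y" "H x y \<Longrightarrow> up y \<le> b x + b y - n - lo x" for x y
    unfolding up_def by (auto intro!: cInf_lower)
  have up_ge: "t \<le> up y" if "t \<le> b y" "\<And>x. H x y \<Longrightarrow> t \<le> b x + b y - n - lo x" for t y
    unfolding up_def using that by (intro cInf_greatest) auto
  have "A x \<le> up x" for x
    using lower[of x] upper[of x] nbr by (intro up_ge) fastforce+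
  then have bounds: "\<forall>x. A x \<le> p x \<and> p x \<le> b x"
    using lower upper up_le(1) by (simp add: p_def)
  have p_edge: "k \<le> p x + p y \<and> n \<le> b x - p x + (b y - p y)" if xy: "H x y" and "colour x" for x y
  proof -
    have "p x = lo x" "p y = up y"
      using \<open>colour x\<close> colour[OF xy] by (simp_all add: p_def)
    moreover have "k - lo x \<le> up y"
      using edge[OF xy] path[OF _ sym[OF xy]] by (intro up_ge) fastforce+
    moreover have "up y \<le> b x + b y - n - lo x"
      by (rule up_le(2)[OF xy])
    moreover have "lo x + n \<le> b x + b y" "lo x \<le> b x" "up y \<le> b y"
      using nbr[OF xy] upper up_le(1) by simp_all
    ultimately show ?thesis
      by arith
  qed
  have "k \<le> p x + p y \<and> n \<le> b x - p x + (b y - p y)" if "H x y" for x y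
    using p_edge[OF that] p_edge[OF sym[OF that]] colour[OF that]
    by (cases "colour x") (auto simp: add.commute)
  then show ?thesis
    unfolding order_cover_def using bounds by blast
qed

lemma ex_order_cover_split:
  fixes b A :: "'v \<Rightarrow> nat" and colour :: "'v \<Rightarrow> bool"
  assumes sym: "\<And>x y. H x y \<Longrightarrow> H y x" and colour: "\<And>x y. H x y \<Longrightarrow> colour x \<noteq> colour y"
    and upper: "\<And>x r. forced_lower H b k n A x r \<Longrightarrow> r \<le> b x"
    and nbr: "\<And>x y r. forced_lower H b k n A x r \<Longrightarrow> H x y \<Longrightarrow> r + A y + n \<le> b x + b y"
  shows "\<exists>p. (\<forall>x. A x \<le> p x \<and> p x \<le> b x) \<and> order_cover H k p \<and> order_cover H n (\<lambda>x. b x - p x)"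
proof -
  have "\<exists>l. forced_lower H b k n A x l \<and> (\<forall>r. forced_lower H b k n A x r \<longrightarrow> r \<le> l)" for x
    using forced_lower.lower[of H b k n A x]
    by (rule Nat.ex_has_greatest_nat[of "forced_lower H b k n A x" _ "b x"]) (simp add: upper)
  then obtain lo where forced: "\<And>x. forced_lower H b k n A x (lo x)"
    and greatest: "\<And>x r. forced_lower H b k n A x r \<Longrightarrow> r \<le> lo x"
    by metis
  show ?thesis
  proof (rule ex_order_cover_split_if_lower[where colour = colour and lo = lo])
    show "A x \<le> lo x" for x
      by (rule greatest[OF forced_lower.lower])
    show "lo x \<le> b x" for x
      by (rule upper[OF forced])
    show "lo x + A y + n \<le> b x + b y" if "H x y" for x y
      by (rule nbr[OF forced that])
    show "k \<le> lo x + b y" if "H x y" for x y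
      using greatest[OF forced_lower.upper[of H, OF that]] by simp
    show "lo z + (k + n) \<le> lo x + b y + b z" if "H z y" "H y x" for x y z
      using greatest[OF forced_lower.step[OF forced that]] by simp
  qed (fact sym colour)+
qed

text \<open>Splitting a cover \<open>b\<close> of order \<open>m\<close> into covers of orders \<open>m - b v\<close> and \<open>b v\<close>, the first vanishing
  at \<open>v\<close>: the first one then has to be at least \<open>m - b v\<close> on the neighbours of \<open>v\<close>.\<close>

abbreviation forced_avoiding :: "('v \<Rightarrow> 'v \<Rightarrow> bool) \<Rightarrow> nat \<Rightarrow> ('v \<Rightarrow> nat) \<Rightarrow> 'v \<Rightarrow> 'v \<Rightarrow> nat \<Rightarrow> bool" where
  "forced_avoiding E m b v \<equiv>
    forced_lower (delete_vertex E v) b (m - b v) (b v) (\<lambda>x. if E v x then m - b v else 0)"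

definition walk_forced :: "('v \<Rightarrow> 'v \<Rightarrow> bool) \<Rightarrow> nat \<Rightarrow> ('v \<Rightarrow> nat) \<Rightarrow> 'v \<Rightarrow> 'v \<Rightarrow> nat \<Rightarrow> bool" where
  "walk_forced E m b v x r \<longleftrightarrow> (\<exists>f h. f 0 = v \<and> f (2 * h + 1) = x \<and>
    (\<forall>i<2 * h + 1. E (f i) (f (Suc i))) \<and> r + (\<Sum>i<2 * h + 1. b (f i)) \<le> m * (h + 1))"

lemma walk_forcedE:
  assumes "walk_forced E m b v x r"
  obtains f h where "f 0 = v" "f (2 * h + 1) = x" "\<And>i. i < 2 * h + 1 \<Longrightarrow> E (f i) (f (Suc i))"
    "r + (\<Sum>i<2 * h + 1. b (f i)) \<le> m * (h + 1)"
  using assms unfolding walk_forced_def by blast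

lemma walk_forced_edge:
  assumes "E v x" "r + b v \<le> m"
  shows "walk_forced E m b v x r"
  unfolding walk_forced_def
  by (rule exI[of _ "\<lambda>i. if i = 0 then v else x"], rule exI[of _ 0]) (use assms in simp)

lemma walk_forced_step:
  assumes "walk_forced E m b v z r" and edges: "E z y" "E y x" and step: "r' + b y + b z \<le> r + m"
  shows "walk_forced E m b v x r'"
proof -
  obtain f h where ends: "f 0 = v" "f (2 * h + 1) = z"
    and walk: "\<And>i. i < 2 * h + 1 \<Longrightarrow> E (f i) (f (Suc i))"
    and weight: "r + (\<Sum>i<2 * h + 1. b (f i)) \<le> m * (h + 1)"
    using walk_forcedE[OF assms(1)] by blast
  define g where "g = f(2 * h + 2 := y, 2 * h + 3 := x)"
  have "E (g i) (g (Suc i))" if "i < 2 * Suc h + 1" for i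
  proof -
    consider "i < 2 * h + 1" | "i = 2 * h + 1" | "i = 2 * h + 2"
      using \<open>i < 2 * Suc h + 1\<close> by fastforce
    then show ?thesis
      using ends(2) walk edges by cases (auto simp: g_def eval_nat_numeral)
  qed
  moreover have "(\<Sum>i<2 * Suc h + 1. b (g i)) = (\<Sum>i<2 * h + 1. b (f i)) + b z + b y"
    using ends(2) by (simp add: g_def)
  then have "r' + (\<Sum>i<2 * Suc h + 1. b (g i)) \<le> m * (Suc h + 1)"
    using weight step by simp
  moreover have "g 0 = v" "g (2 * Suc h + 1) = x"
    using ends(1) by (simp_all add: g_def eval_nat_numeral)
  ultimately show ?thesis
    unfolding walk_forced_def by blast
qed

lemma walk_forced_le:
  assumes cover: "order_cover E m b" and forced: "walk_forced E m b v x r"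
  shows "r \<le> b x" "r + b v \<le> m"
proof -
  obtain f h where ends: "f 0 = v" "f (2 * h + 1) = x"
    and walk: "\<And>i. i < 2 * h + 1 \<Longrightarrow> E (f i) (f (Suc i))"
    and weight: "r + (\<Sum>i<2 * h + 1. b (f i)) \<le> m * (h + 1)"
    using walk_forcedE[OF forced] by blast
  have "(\<Sum>i<0. b (f i)) + m * (h + 1) \<le> (\<Sum>i<0 + 2 * (h + 1). b (f i))"
    using walk by (intro order_cover_sum_walk[OF cover]) simp
  then show "r \<le> b x"
    using ends(2) weight by simp
  have "(\<Sum>i<1. b (f i)) + m * h \<le> (\<Sum>i<1 + 2 * h. b (f i))"
    using walk by (intro order_cover_sum_walk[OF cover]) simp
  then show "r + b v \<le> m"
    using ends(1) weight by simp
qed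

lemma walk_forced_closed_le:
  assumes odd_walks: "\<And>F k. closed_walk E F k \<Longrightarrow> odd k \<Longrightarrow> m * ((k + 1) div 2) \<le> (\<Sum>i<k. b (F i))"
    and forced: "walk_forced E m b v x r" and edges: "E x y" "E y v"
  shows "r + m \<le> b x + b y"
proof -
  obtain f h where ends: "f 0 = v" "f (2 * h + 1) = x"
    and walk: "\<And>i. i < 2 * h + 1 \<Longrightarrow> E (f i) (f (Suc i))"
    and weight: "r + (\<Sum>i<2 * h + 1. b (f i)) \<le> m * (h + 1)"
    using walk_forcedE[OF forced] by blast
  define g where "g = f(2 * h + 2 := y)"
  have "E (g i) (g (Suc i))" if "i < 2 * h + 2" for i
  proof -
    consider "i < 2 * h + 1" | "i = 2 * h + 1"
      using \<open>i < 2 * h + 2\<close> by fastforce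
    then show ?thesis
      using ends(2) walk edges(1) by cases (auto simp: g_def)
  qed
  moreover have "E (g (2 * h + 2)) (g 0)"
    using edges(2) ends(1) by (simp add: g_def)
  ultimately have "closed_walk E (\<lambda>i. g (i mod Suc (2 * h + 2))) (Suc (2 * h + 2))"
    by (rule closed_walk_mod_Suc)
  then have "m * (h + 2) \<le> (\<Sum>i<Suc (2 * h + 2). b (g (i mod Suc (2 * h + 2))))"
    using odd_walks by fastforce
  also have "\<dots> = (\<Sum>i<2 * h + 1. b (f i)) + b x + b y"
    using ends(2) by (simp add: g_def)
  finally show ?thesis
    using weight by simp
qed

lemma forced_avoiding_cases:
  assumes simple: "simple_graph E" and cover: "order_cover E m b" and "b v \<le> m"
    and "forced_avoiding E m b v x r"
  shows "r = 0 \<or> (\<exists>y. E x y \<and> r + b y + b v \<le> m) \<or> walk_forced E m b v x r"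
  using assms(4)
proof (induction rule: forced_lower.induct)
  case (lower x)
  then show ?case
    using \<open>b v \<le> m\<close> by (simp add: walk_forced_edge)
next
  case (upper x y)
  then show ?case
    by (auto simp: delete_vertex_def intro!: exI[of _ y])
next
  case (step z r y x)
  let ?r = "r + (m - b v + b v) - (b y + b z)"
  have edges: "E z y" "E y x" "m \<le> b z + b y"
    using step.hyps order_coverD[OF cover] by (auto simp: delete_vertex_def)
  consider (zero) "?r = 0" | (nbr) y' where "?r > 0" "E z y'" "r + b y' + b v \<le> m"
    | (walk) "?r > 0" "walk_forced E m b v z r"
    using step.IH edges(3) \<open>b v \<le> m\<close> by fastforce
  then show ?case
  proof cases
    case nbr
    then have "?r + b y + b v \<le> m"
      using order_coverD[OF cover nbr(2)] edges(3) \<open>b v \<le> m\<close> by linarith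
    then show ?thesis
      using edges(2) simple_graph_sym[OF simple] by blast
  next
    case walk
    then have "walk_forced E m b v x ?r"
      using \<open>b v \<le> m\<close> by (intro walk_forced_step[OF walk(2) edges(1,2)]) simp
    then show ?thesis
      by blast
  qed simp
qed

lemma forced_avoiding_le:
  assumes "simple_graph E" and cover: "order_cover E m b" and "b v \<le> m" "forced_avoiding E m b v x r"
  shows "r \<le> b x"
proof -
  consider (zero) "r = 0" | (nbr) y where "E x y" "r + b y + b v \<le> m" | (walk) "walk_forced E m b v x r"
    using forced_avoiding_cases[OF assms] by blast
  then show ?thesis
  proof cases
    case nbr
    then show ?thesis
      using order_coverD[OF cover nbr(1)] by simp
  next
    case walk
    then show ?thesis
      by (rule walk_forced_le(1)[OF cover])
  qed simp
qed

lemma forced_avoiding_le_nbr: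
  assumes simple: "simple_graph E" and cover: "order_cover E m b" and "b v \<le> m"
    and forced: "forced_avoiding E m b v x r" and "E x y"
    and odd_walks: "\<And>F k. closed_walk E F k \<Longrightarrow> odd k \<Longrightarrow> m * ((k + 1) div 2) \<le> (\<Sum>i<k. b (F i))"
  shows "r + (if E v y then m - b v else 0) + b v \<le> b x + b y"
proof -
  have xy: "m \<le> b x + b y"
    by (rule order_coverD[OF cover \<open>E x y\<close>])
  consider (zero) "r = 0" | (nbr) y' where "E x y'" "r + b y' + b v \<le> m" | (walk) "walk_forced E m b v x r"
    using forced_avoiding_cases[OF simple cover \<open>b v \<le> m\<close> forced] by blast
  then show ?thesis
  proof cases
    case zero
    then show ?thesis
      using xy \<open>b v \<le> m\<close> by simp
  next
    case nbr
    then show ?thesis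
      using xy \<open>b v \<le> m\<close> order_coverD[OF cover nbr(1)] order_coverD[OF cover, of v y] by auto
  next
    case walk
    have "r + m \<le> b x + b y" if "E v y"
      by (rule walk_forced_closed_le[OF odd_walks walk \<open>E x y\<close> simple_graph_sym[OF simple that]])
    then show ?thesis
      using walk_forced_le(2)[OF cover walk] xy \<open>b v \<le> m\<close> by auto
  qed
qed

lemma ex_order_cover_split_at_vertex:
  fixes colour :: "'v \<Rightarrow> bool"
  assumes simple: "simple_graph E" and cover: "order_cover E m b" and "b v \<le> m"
    and colour: "\<And>x y. delete_vertex E v x y \<Longrightarrow> colour x \<noteq> colour y"
    and odd_walks: "\<And>F k. closed_walk E F k \<Longrightarrow> odd k \<Longrightarrow> m * ((k + 1) div 2) \<le> (\<Sum>i<k. b (F i))"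
  shows "\<exists>p. p v = 0 \<and> (\<forall>x. p x \<le> b x) \<and> (\<forall>x. E v x \<longrightarrow> m - b v \<le> p x) \<and>
    order_cover E (m - b v) p \<and> order_cover E (b v) (\<lambda>x. b x - p x)"
proof -
  note sym = simple_graph_sym[OF simple]
  have "\<exists>p. (\<forall>x. (if E v x then m - b v else 0) \<le> p x \<and> p x \<le> b x) \<and>
    order_cover (delete_vertex E v) (m - b v) p \<and>
    order_cover (delete_vertex E v) (b v) (\<lambda>x. b x - p x)"
    by (rule ex_order_cover_split[where colour = colour])
      (use colour sym forced_avoiding_le[OF simple cover \<open>b v \<le> m\<close>]
        forced_avoiding_le_nbr[OF simple cover \<open>b v \<le> m\<close> _ _ odd_walks] in
        \<open>auto simp: delete_vertex_def\<close>)
  then obtain p where lower: "\<And>x. (if E v x then m - b v else 0) \<le> p x" and upper: "\<And>x. p x \<le> b x"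
    and p_covers: "order_cover (delete_vertex E v) (m - b v) p"
      "order_cover (delete_vertex E v) (b v) (\<lambda>x. b x - p x)"
    by blast
  have nbr: "m - b v \<le> p x" if "E v x" for x
    using lower[of x] that by simp
  define q where "q = p(v := 0)"
  have "m - b v \<le> q x + q y \<and> b v \<le> b x - q x + (b y - q y)" if "E x y" for x y
  proof (cases "x = v \<or> y = v")
    case True
    then show ?thesis
      using nbr[of x] nbr[of y] sym[OF that] that simple_graph_irrefl[OF simple, of v]
      by (auto simp: q_def)
  next
    case False
    then show ?thesis
      using p_covers[THEN order_coverD, of x y] that by (simp add: q_def delete_vertex_def)
  qed
  then have "order_cover E (m - b v) q" "order_cover E (b v) (\<lambda>x. b x - q x)"
    by (simp_all add: order_cover_def)
  then show ?thesis
    using upper nbr simple_graph_irrefl[OF simple, of v] by (intro exI[of _ q]) (auto simp: q_def)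
qed

lemma covers_split_in_exponent_pow:
  fixes a :: "'v::finite \<Rightarrow>\<^sub>0 nat" and colour :: "'v \<Rightarrow> bool"
  assumes simple: "simple_graph E" and colour: "\<And>x y. delete_vertex E v x y \<Longrightarrow> colour x \<noteq> colour y"
    and "p v = 0" and upper: "\<And>x. p x \<le> lookup a x" and nbr: "\<And>x. E v x \<Longrightarrow> k \<le> p x"
    and p_cover: "order_cover E k p" and diff_cover: "order_cover E (lookup a v) (\<lambda>x. lookup a x - p x)"
  shows "a \<in> exponent_pow (covers E 1) (k + lookup a v)"
proof -
  define b where "b = Abs_poly_mapping p"
  have lookup_b: "lookup b = p"
    by (simp add: b_def)
  have lookup_diff: "lookup (a - b) = (\<lambda>x. lookup a x - p x)"
    by (simp add: fun_eq_iff lookup_minus lookup_b)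
  have "b \<in> exponent_pow (covers E 1) k"
  proof (rule covers_coloured_in_exponent_pow)
    show "colour x \<noteq> colour y" if "E x y" "lookup b x < k" "lookup b y < k" for x y
      using that nbr[of x] nbr[of y] simple_graph_sym[OF simple that(1)]
      by (intro colour) (auto simp: delete_vertex_def lookup_b)
  qed (use p_cover in \<open>simp add: covers_def lookup_b\<close>)
  moreover have "a - b \<in> exponent_pow (covers E 1) (lookup a v)"
  proof (rule covers_coloured_in_exponent_pow)
    show "colour x \<noteq> colour y"
      if "E x y" "lookup (a - b) x < lookup a v" "lookup (a - b) y < lookup a v" for x y
      using that \<open>p v = 0\<close> by (intro colour) (auto simp: delete_vertex_def lookup_diff)
  qed (use diff_cover in \<open>simp add: covers_def lookup_diff\<close>)
  ultimately have "b + (a - b) \<in> exponent_pow (covers E 1) (k + lookup a v)"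
    by (rule exponent_pow_add)
  moreover have "b + (a - b) = a"
    by (rule poly_mapping_eqI) (simp add: lookup_add lookup_b lookup_diff upper)
  ultimately show ?thesis
    by simp
qed

lemma covers_in_exponent_pow_if_bipartite_delete_vertex:
  fixes a :: "'v::finite \<Rightarrow>\<^sub>0 nat"
  assumes simple: "simple_graph E" and "bipartite (delete_vertex E v)" and cover: "a \<in> covers E m"
    and odd_walks: "\<And>F k. closed_walk E F k \<Longrightarrow> odd k \<Longrightarrow> m * ((k + 1) div 2) \<le> (\<Sum>i<k. lookup a (F i))"
  shows "a \<in> exponent_pow (covers E 1) m"
proof -
  obtain colour :: "'v \<Rightarrow> bool" where colour: "\<And>x y. delete_vertex E v x y \<Longrightarrow> colour x \<noteq> colour y"
    using assms(2) unfolding bipartite_def by blast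
  show ?thesis
  proof (cases "m \<le> lookup a v")
    case True
    show ?thesis
      using cover
    proof (rule covers_coloured_in_exponent_pow)
      show "colour x \<noteq> colour y" if "E x y" "lookup a x < m" "lookup a y < m" for x y
        using that True by (intro colour) (auto simp: delete_vertex_def)
    qed
  next
    case False
    have "\<exists>p. p v = 0 \<and> (\<forall>x. p x \<le> lookup a x) \<and> (\<forall>x. E v x \<longrightarrow> m - lookup a v \<le> p x) \<and>
      order_cover E (m - lookup a v) p \<and> order_cover E (lookup a v) (\<lambda>x. lookup a x - p x)"
      using cover False
      by (intro ex_order_cover_split_at_vertex[where colour = colour] simple colour odd_walks)
        (simp_all add: covers_def)
    then obtain p where "p v = 0" "\<And>x. p x \<le> lookup a x" "\<And>x. E v x \<Longrightarrow> m - lookup a v \<le> p x"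
      "order_cover E (m - lookup a v) p" "order_cover E (lookup a v) (\<lambda>x. lookup a x - p x)"
      by blast
    then have "a \<in> exponent_pow (covers E 1) (m - lookup a v + lookup a v)"
      by (intro covers_split_in_exponent_pow[where colour = colour] simple colour)
    then show ?thesis
      using False by simp
  qed
qed

section \<open>Powers of the cover ideal\<close>

definition edges :: "('v \<Rightarrow> 'v \<Rightarrow> bool) \<Rightarrow> 'v set set" where
  "edges E = {{u, v} |u v. E u v}"

lemma image_edges: "f ` edges E = {f {u, v} |u v. E u v}"
  by (auto simp: edges_def)

lemma ball_edges: "(\<forall>A\<in>edges E. P A) \<longleftrightarrow> (\<forall>u v. E u v \<longrightarrow> P {u, v})"
  unfolding edges_def by blast

lemma finite_edge: "A \<in> edges E \<Longrightarrow> finite A"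
  by (auto simp: edges_def)

lemma edgesE:
  assumes "simple_graph E" "A \<in> edges E"
  obtains u v where "A = {u, v}" "E u v" "u \<noteq> v"
proof -
  obtain u v where edge: "A = {u, v}" "E u v"
    using assms(2) by (auto simp: edges_def)
  then have "u \<noteq> v"
    using simple_graph_irrefl[OF assms(1)] by blast
  with edge show thesis
    by (rule that)
qed

lemma card_edge: "simple_graph E \<Longrightarrow> A \<in> edges E \<Longrightarrow> card A = 2"
  by (auto elim: edgesE)

lemma induced_odd_cycle_not_edge:
  assumes "simple_graph E" "induced_odd_cycle E S"
  shows "S \<notin> edges E"
  using assms card_edge induced_odd_cycle_card(2) by fastforce

lemma covers_eq_degree_bounds:
  assumes simple: "simple_graph E"
  shows "covers E m = {a. \<forall>A\<in>edges E. m \<le> degree_in A a}"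
proof -
  have "degree_in {u, v} a = lookup a u + lookup a v" if "E u v" for u v a
    using simple_graph_irrefl[OF simple] that by (cases "u = v") (auto simp: degree_in_def)
  then show ?thesis
    by (auto simp: covers_def order_cover_def ball_edges)
qed

lemma is_ideal_cover_ideal: "is_ideal (cover_ideal E)"
  unfolding cover_ideal_def by (rule is_ideal_Inter) (auto simp: is_ideal_ideal_gen)

lemma cover_ideal_eq_mon_ideal:
  assumes "simple_graph E"
  shows "cover_ideal E = (mon_ideal (covers E 1) :: ('v, 'k::field) mpoly set)"
proof -
  have "cover_ideal E = (\<Inter>A\<in>edges E. var_prime A :: ('v, 'k) mpoly set)"
    by (simp add: cover_ideal_def image_edges)
  also have "\<dots> = (\<Inter>A\<in>edges E. degree_ideal A 1)"
    by (simp add: var_prime_eq_degree_ideal finite_edge)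
  finally show ?thesis
    by (simp add: covers_eq_degree_bounds[OF assms] mon_ideal_degree_bounds)
qed

lemma ideal_pow_cover_ideal:
  "simple_graph E \<Longrightarrow>
    ideal_pow (cover_ideal E :: ('v, 'k::field) mpoly set) m = mon_ideal (exponent_pow (covers E 1) m)"
  by (simp add: cover_ideal_eq_mon_ideal ideal_pow_mon_ideal)

lemma degree_in_induced_odd_cycle_ge:
  assumes "induced_odd_cycle E S" "a \<in> covers E 1"
  shows "(card S + 1) div 2 \<le> degree_in S a"
  using order_cover_sum_induced_odd_cycle[of E 1 "lookup a" S] assms
  by (simp add: covers_def degree_in_def)

lemma exponent_pow_covers_bipartite:
  fixes E :: "'v::finite \<Rightarrow> 'v \<Rightarrow> bool"
  assumes "bipartite E"
  shows "exponent_pow (covers E 1) m = covers E m"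
proof
  obtain c :: "'v \<Rightarrow> bool" where "\<And>u v. E u v \<Longrightarrow> c u \<noteq> c v"
    using assms unfolding bipartite_def by blast
  then show "covers E m \<subseteq> exponent_pow (covers E 1) m"
    using covers_coloured_in_exponent_pow[of _ E m c] by blast
qed (rule exponent_pow_covers_subset)

lemma exponent_pow_covers_almost_bipartite:
  fixes E :: "'v::finite \<Rightarrow> 'v \<Rightarrow> bool"
  assumes simple: "simple_graph E" and cycle: "induced_odd_cycle E S"
    and unique: "\<And>S'. induced_odd_cycle E S' \<Longrightarrow> S' = S"
  shows "exponent_pow (covers E 1) m = {a \<in> covers E m. m * ((card S + 1) div 2) \<le> degree_in S a}"
proof
  show "exponent_pow (covers E 1) m \<subseteq> {a \<in> covers E m. m * ((card S + 1) div 2) \<le> degree_in S a}"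
    using exponent_pow_covers_subset[of E m]
      degree_in_exponent_pow_ge[OF degree_in_induced_odd_cycle_ge[OF cycle]] by blast
  obtain v where "v \<in> S"
    using induced_odd_cycle_card(2)[OF cycle] by fastforce
  then have bip: "bipartite (delete_vertex E v)"
    using unique by (intro bipartite_delete_vertex[OF simple]) blast
  show "{a \<in> covers E m. m * ((card S + 1) div 2) \<le> degree_in S a} \<subseteq> exponent_pow (covers E 1) m"
  proof clarify
    fix a assume a: "a \<in> covers E m" "m * ((card S + 1) div 2) \<le> degree_in S a"
    have "m * ((k + 1) div 2) \<le> (\<Sum>i<k. lookup a (F i))" if "closed_walk E F k" "odd k" for F k
      using a unique that
      by (intro order_cover_sum_odd_closed_walk[OF simple]) (auto simp: covers_def degree_in_def)
    then show "a \<in> exponent_pow (covers E 1) m"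
      by (rule covers_in_exponent_pow_if_bipartite_delete_vertex[OF simple bip a(1)])
  qed
qed

section \<open>Associated primes of powers of the cover ideal\<close>

lemma degree_in_compl_indicator: "degree_in A (compl_indicator T) = card (A - T)"
  by (simp add: degree_in_def lookup_compl_indicator sum_of_bool_eq set_diff_eq Int_def)

lemma single_plus_compl_indicator:
  "v \<in> T \<Longrightarrow> single v 1 + compl_indicator T = compl_indicator (T - {v})"
  by (rule poly_mapping_eqI) (auto simp: lookup_add lookup_single lookup_compl_indicator when_def)

lemma compl_indicator_disjoint_Un:
  "T0 \<inter> T1 = {} \<Longrightarrow>
    compl_indicator (T0 \<union> T1) + compl_indicator {} = compl_indicator T0 + compl_indicator T1"
  by (rule poly_mapping_eqI) (auto simp: lookup_add lookup_compl_indicator)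

lemma edge_prime_in_Ass_pow:
  fixes E :: "'v::finite \<Rightarrow> 'v \<Rightarrow> bool"
  assumes simple: "simple_graph E" and edge: "A \<in> edges E" and "1 \<le> m"
  shows "var_prime A \<in> Ass (ideal_pow (cover_ideal E :: ('v, 'k::field) mpoly set) m)"
proof -
  obtain u v where endpoints: "A = {u, v}" "u \<noteq> v"
    using edgesE[OF simple edge] .
  have indep: "independent E {x}" for x
    using simple_graph_irrefl[OF simple] by (simp add: independent_def)
  show ?thesis
    unfolding cover_ideal_eq_mon_ideal[OF simple]
  proof (rule var_prime_in_Ass_pow)
    show "1 \<le> degree_in A b" if "b \<in> covers E 1" for b
      using that edge by (simp add: covers_eq_degree_bounds[OF simple])
    show "compl_indicator {u} \<in> covers E 1"
      by (rule compl_indicator_in_covers[OF indep])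
    show "degree_in A (compl_indicator {u}) = 1"
      using endpoints by (simp add: degree_in_compl_indicator)
    show "Suc (degree_in A (compl_indicator A)) = 1 * 1"
      by (simp add: degree_in_compl_indicator)
    fix x assume "x \<in> A"
    then have "independent E (A - {x})"
      using endpoints indep by (auto simp: insert_Diff_if)
    then have "compl_indicator (A - {x}) \<in> exponent_pow (covers E 1) 1"
      using compl_indicator_in_covers subset_exponent_pow_1 by blast
    then show "single x 1 + compl_indicator A \<in> exponent_pow (covers E 1) 1"
      by (simp only: single_plus_compl_indicator[OF \<open>x \<in> A\<close>])
  qed (use \<open>1 \<le> m\<close> in simp_all)
qed

lemma odd_cycle_prime_in_Ass_pow:
  fixes E :: "'v::finite \<Rightarrow> 'v \<Rightarrow> bool"
  assumes simple: "simple_graph E" and cycle: "induced_odd_cycle E S" and "2 \<le> m"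
  shows "var_prime S \<in> Ass (ideal_pow (cover_ideal E :: ('v, 'k::field) mpoly set) m)"
proof -
  have odd: "odd (card S)" and "S \<noteq> {}"
    using induced_odd_cycle_card[OF cycle] by auto
  then obtain T where "independent E T" "T \<subseteq> S" and card_T: "card T = card S div 2"
    using induced_odd_cycle_minus_vertex[OF cycle] by (metis Diff_subset Un_upper1 ex_in_conv order_trans)
  show ?thesis
    unfolding cover_ideal_eq_mon_ideal[OF simple]
  proof (rule var_prime_in_Ass_pow)
    show "(card S + 1) div 2 \<le> degree_in S b" if "b \<in> covers E 1" for b
      using cycle that by (rule degree_in_induced_odd_cycle_ge)
    show "compl_indicator T \<in> covers E 1"
      by (rule compl_indicator_in_covers[OF \<open>independent E T\<close>])
    show "degree_in S (compl_indicator T) = (card S + 1) div 2"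
      using \<open>T \<subseteq> S\<close> card_T odd by (auto simp: degree_in_compl_indicator card_Diff_subset elim!: oddE)
    show "Suc (degree_in S (compl_indicator S + compl_indicator {})) = 2 * ((card S + 1) div 2)"
      using odd by (simp add: degree_in_plus degree_in_compl_indicator)
    fix v assume "v \<in> S"
    then obtain T0 T1 where indep: "independent E T0" "independent E T1"
        and disjoint: "T0 \<inter> T1 = {}" and union: "T0 \<union> T1 = S - {v}"
      using induced_odd_cycle_minus_vertex[OF cycle] by metis
    have "single v 1 + (compl_indicator S + compl_indicator {})
        = compl_indicator (S - {v}) + compl_indicator {}"
      by (simp only: single_plus_compl_indicator[OF \<open>v \<in> S\<close>] flip: add.assoc)
    also have "\<dots> = compl_indicator T0 + compl_indicator T1"
      using compl_indicator_disjoint_Un[OF disjoint] union by simp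
    also have "\<dots> \<in> exponent_pow (covers E 1) (1 + 1)"
      using indep compl_indicator_in_covers subset_exponent_pow_1 by (blast intro: exponent_pow_add)
    finally show "single v 1 + (compl_indicator S + compl_indicator {}) \<in> exponent_pow (covers E 1) 2"
      by (simp only: one_add_one)
  qed (use \<open>2 \<le> m\<close> in simp_all)
qed

lemma Ass_pow_cover_ideal_bipartite:
  fixes E :: "'v::finite \<Rightarrow> 'v \<Rightarrow> bool"
  assumes simple: "simple_graph E" and "bipartite E" "1 \<le> m"
  shows "Ass (ideal_pow (cover_ideal E :: ('v, 'k::field) mpoly set) m) = var_prime ` edges E"
proof
  have pow_eq: "exponent_pow (covers E 1) m = {a. \<forall>A\<in>edges E. m \<le> degree_in A a}"
    using exponent_pow_covers_bipartite[OF assms(2)] covers_eq_degree_bounds[OF simple] by metis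
  show "Ass (ideal_pow (cover_ideal E :: ('v, 'k) mpoly set) m) \<subseteq> var_prime ` edges E"
    unfolding ideal_pow_cover_ideal[OF simple] pow_eq by (rule Ass_degree_bounds_subset) simp_all
qed (use edge_prime_in_Ass_pow[OF simple _ \<open>1 \<le> m\<close>] in blast)

lemma Ass_cover_ideal:
  fixes E :: "'v::finite \<Rightarrow> 'v \<Rightarrow> bool"
  assumes simple: "simple_graph E"
  shows "Ass (cover_ideal E :: ('v, 'k::field) mpoly set) = var_prime ` edges E"
proof
  show "Ass (cover_ideal E :: ('v, 'k) mpoly set) \<subseteq> var_prime ` edges E"
    unfolding cover_ideal_eq_mon_ideal[OF simple] covers_eq_degree_bounds[OF simple]
    by (rule Ass_degree_bounds_subset) simp_all
  show "var_prime ` edges E \<subseteq> Ass (cover_ideal E :: ('v, 'k) mpoly set)"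
    using edge_prime_in_Ass_pow[OF simple _ order_refl] by (auto simp only: ideal_pow_1[OF is_ideal_cover_ideal])
qed

lemma Ass_pow_cover_ideal_almost_bipartite:
  fixes E :: "'v::finite \<Rightarrow> 'v \<Rightarrow> bool"
  assumes simple: "simple_graph E" and cycle: "induced_odd_cycle E S"
    and unique: "\<And>S'. induced_odd_cycle E S' \<Longrightarrow> S' = S" and "2 \<le> m"
  shows "Ass (ideal_pow (cover_ideal E :: ('v, 'k::field) mpoly set) m)
    = insert (var_prime S) (var_prime ` edges E)"
proof
  let ?D = "{a. \<forall>A\<in>insert S (edges E). m * ((card A + 1) div 2) \<le> degree_in A a}"
  have "exponent_pow (covers E 1) m = {a \<in> covers E m. m * ((card S + 1) div 2) \<le> degree_in S a}"
    using simple cycle unique by (rule exponent_pow_covers_almost_bipartite)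
  also have "\<dots> = ?D"
    by (auto simp: covers_eq_degree_bounds[OF simple] card_edge[OF simple])
  finally have pow_eq: "exponent_pow (covers E 1) m = ?D" .
  have "Ass (mon_ideal ?D :: ('v, 'k) mpoly set) \<subseteq> var_prime ` insert S (edges E)"
    by (rule Ass_degree_bounds_subset) simp_all
  then show "Ass (ideal_pow (cover_ideal E :: ('v, 'k) mpoly set) m)
      \<subseteq> insert (var_prime S) (var_prime ` edges E)"
    unfolding ideal_pow_cover_ideal[OF simple] pow_eq image_insert .
qed (use edge_prime_in_Ass_pow[OF simple, of _ m] odd_cycle_prime_in_Ass_pow[OF simple cycle] \<open>2 \<le> m\<close> in auto)

lemma monomial_prime_var_prime: "monomial_prime (var_prime A)"
  by (auto simp: monomial_prime_def)

lemma nearly_copersistentD: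
  assumes "is_ideal I" "nearly_copersistent I"
  obtains p where "Ass (ideal_pow I 2) \<subseteq> insert p (Ass I)"
proof -
  obtain s p where "s \<ge> 1"
    "\<forall>m. 1 \<le> m \<and> m \<le> s \<longrightarrow> Ass (ideal_pow I (m + 1)) \<subseteq> Ass (ideal_pow I m) \<union> {p}"
    using assms(2) unfolding nearly_copersistent_def by (elim exE conjE)
  then have "Ass (ideal_pow I 2) \<subseteq> Ass (ideal_pow I 1) \<union> {p}"
    by (metis one_add_one order_refl)
  then show thesis
    using that unfolding ideal_pow_1[OF assms(1)] by blast
qed

lemma nearly_copersistentI:
  assumes "is_ideal I" "monomial_prime p" "Ass (ideal_pow I 2) \<subseteq> insert p (Ass I)"
    and "\<And>m. m \<ge> 2 \<Longrightarrow> Ass (ideal_pow I (m + 1)) \<subseteq> Ass (ideal_pow I m)"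
  shows "nearly_copersistent I"
  unfolding nearly_copersistent_def
proof (intro exI conjI allI impI)
  show "Ass (ideal_pow I (m + 1)) \<subseteq> Ass (ideal_pow I m) \<union> {p}" if "1 \<le> m \<and> m \<le> 1" for m
  proof -
    have "m = 1"
      using that by simp
    then show ?thesis
      using assms(3) by (simp only: one_add_one ideal_pow_1[OF assms(1)]) blast
  qed
  show "Ass (ideal_pow I (m + 1)) \<subseteq> Ass (ideal_pow I m)" if "m \<ge> 1 + 1" for m
    using assms(4) that by simp
qed (use assms(2) in simp_all)

lemma nearly_copersistent_cover_ideal_imp_unique_induced_odd_cycle:
  fixes E :: "'v::finite \<Rightarrow> 'v \<Rightarrow> bool"
  assumes simple: "simple_graph E" and near: "nearly_copersistent (cover_ideal E :: ('v, 'k::field) mpoly set)"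
    and "induced_odd_cycle E S" "induced_odd_cycle E S'"
  shows "S = S'"
proof -
  let ?J = "cover_ideal E :: ('v, 'k) mpoly set"
  obtain p where p: "Ass (ideal_pow ?J 2) \<subseteq> insert p (Ass ?J)"
    using nearly_copersistentD[OF is_ideal_cover_ideal near] .
  have "var_prime T = p" if "induced_odd_cycle E T" for T
  proof -
    have "var_prime T \<notin> Ass ?J"
      unfolding Ass_cover_ideal[OF simple]
      using var_prime_inject[of T, where 'k = 'k] induced_odd_cycle_not_edge[OF simple that] by auto
    then show ?thesis
      using p odd_cycle_prime_in_Ass_pow[OF simple that, of 2, where 'k = 'k] by auto
  qed
  then show ?thesis
    using assms(3,4) var_prime_inject[of S S', where 'k = 'k] by simp
qed

lemma nearly_copersistent_cover_ideal_bipartite: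
  fixes E :: "'v::finite \<Rightarrow> 'v \<Rightarrow> bool"
  assumes simple: "simple_graph E" and "bipartite E"
  shows "nearly_copersistent (cover_ideal E :: ('v, 'k::field) mpoly set)"
proof (rule nearly_copersistentI[OF is_ideal_cover_ideal monomial_prime_var_prime])
  note Ass_pow = Ass_pow_cover_ideal_bipartite[OF assms, where 'k = 'k]
  show "Ass (ideal_pow (cover_ideal E :: ('v, 'k) mpoly set) 2)
      \<subseteq> insert (var_prime {}) (Ass (cover_ideal E))"
    using Ass_pow[of 2] Ass_cover_ideal[OF simple, where 'k = 'k] by auto
  show "Ass (ideal_pow (cover_ideal E :: ('v, 'k) mpoly set) (m + 1)) \<subseteq> Ass (ideal_pow (cover_ideal E) m)"
    if "m \<ge> 2" for m
    using Ass_pow[of m] Ass_pow[of "m + 1"] that by simp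
qed

lemma nearly_copersistent_cover_ideal_almost_bipartite:
  fixes E :: "'v::finite \<Rightarrow> 'v \<Rightarrow> bool"
  assumes simple: "simple_graph E" and "almost_bipartite E"
  shows "nearly_copersistent (cover_ideal E :: ('v, 'k::field) mpoly set)"
proof -
  obtain S where "induced_odd_cycle E S" "\<And>S'. induced_odd_cycle E S' \<Longrightarrow> S' = S"
    using assms(2) unfolding almost_bipartite_def by blast
  then have Ass_pow: "Ass (ideal_pow (cover_ideal E :: ('v, 'k) mpoly set) m)
      = insert (var_prime S) (var_prime ` edges E)" if "2 \<le> m" for m
    using that by (rule Ass_pow_cover_ideal_almost_bipartite[OF simple])
  show ?thesis
  proof (rule nearly_copersistentI[OF is_ideal_cover_ideal monomial_prime_var_prime])
    show "Ass (ideal_pow (cover_ideal E :: ('v, 'k) mpoly set) 2)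
        \<subseteq> insert (var_prime S) (Ass (cover_ideal E))"
      using Ass_pow[of 2] Ass_cover_ideal[OF simple, where 'k = 'k] by simp
    show "Ass (ideal_pow (cover_ideal E :: ('v, 'k) mpoly set) (m + 1)) \<subseteq> Ass (ideal_pow (cover_ideal E) m)"
      if "m \<ge> 2" for m
      using Ass_pow[of m] Ass_pow[of "m + 1"] that by simp
  qed
qed

theorem theorem4p1:
  fixes E :: "'v::finite \<Rightarrow> 'v \<Rightarrow> bool"
  assumes "simple_graph E" and "connected_graph E"
  shows "nearly_copersistent (cover_ideal E :: ('v, 'k::field) mpoly set)
         \<longleftrightarrow> bipartite E \<or> almost_bipartite E"
proof
  assume "nearly_copersistent (cover_ideal E :: ('v, 'k) mpoly set)"
  then have "S = S'" if "induced_odd_cycle E S" "induced_odd_cycle E S'" for S S'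
    using nearly_copersistent_cover_ideal_imp_unique_induced_odd_cycle[OF assms(1)] that by blast
  then show "bipartite E \<or> almost_bipartite E"
    using bipartite_if_no_induced_odd_cycle[OF assms(1)] unfolding almost_bipartite_def by blast
next
  assume "bipartite E \<or> almost_bipartite E"
  then show "nearly_copersistent (cover_ideal E :: ('v, 'k) mpoly set)"
    using nearly_copersistent_cover_ideal_bipartite[OF assms(1)]
      nearly_copersistent_cover_ideal_almost_bipartite[OF assms(1)] by blast
qed

end
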